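(* Let $\mathbb{F}$ be a field, $K$ a finite simplicial complex, $P$ a finite poset, and $F : P \to \Delta K$ a filtration. Let $d$ be a degree, and let $\phi$ be any free presentation of the homology persistence module $H_d |F| : P \to \mathsf{Vec}$. Then $\partial ZB_d F \sim \partial ZB\phi$; that is, $\partial ZB_d F[a,b] = \partial ZB\phi[a,b]$ for all $a < b$ in $P$.
   Context: Posets. For a poset $P$, $\mathrm{Int}\, P$ is the poset of intervals $[a,b]$ with $a \le b$ in $P$, with the product order: $[a,b] \le [c,d]$ iff $a \le c$ and $b \le d$. For a finite poset $Q$ and $m : Q \to \mathbb{Z}$, the Möbius inversion $\partial m : Q \to \mathbb{Z}$ is the unique function with $m(b) = \sum_{a \le b} \partial m(a)$ for all $b \in Q$. Two functions $m, n : \mathrm{Int}\, P \to \mathbb{Z}$ are equivalent, written $m \sim n$, if $m[a,b] = n[a,b]$ for all $a < b$ in $P$. Filtrations. A subcomplex of $K$ is a set of simplices $A \subseteq K$ closed under passing to faces; $\Delta K$ is the poset of subcomplexes of $K$ ordered by inclusion. A filtration of $K$ indexed by $P$ is a monotone function $F : P \to \Delta K$. Let $C_\bullet F(a)$ be the simplicial chain complex of $F(a)$ over $\mathbb{F}$, with cycle spaces $Z_d F(a)$ and boundary spaces $B_d F(a)$; for $a \le b$ inclusion gives $Z_d F(a) \subseteq Z_d F(b)$ and $B_d F(a)\subseteq B_d F(b)$. The $d$-th birth-death function $ZB_d F : \mathrm{Int}\, P \to \mathbb{Z}$ is $ZB_d F[a,b] = \dim_{\mathbb{F}}\big(Z_d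 F(a) \cap B_d F(b)\big)$, the intersection being taken in $Z_d F(b)$. Persistence modules. $\mathsf{Vec}$ is the category of finite dimensional $\mathbb{F}$-vector spaces. A $P$-module (persistence module) is a functor $M : P \to \mathsf{Vec}$. For $a \in P$, $\mathbb{F}^{\uparrow a}$ is the $P$-module with $\mathbb{F}^{\uparrow a}(b) = \mathbb{F}$ if $a \le b$ and $0$ otherwise, and $\mathbb{F}^{\uparrow a}(b \le c) = 1_{\mathbb{F}}$ for all $a \le b \le c$. A $P$-module is free if it is a direct sum of modules of the form $\mathbb{F}^{\uparrow a}$. A (free) presentation of $M$ is a surjective natural transformation $\phi : E \Rightarrow M$ from a free $P$-module $E$. Its birth-death function $ZB\phi : \mathrm{Int}\, P \to \mathbb{Z}$ is $ZB\phi[a,b] = \dim_{\mathbb{F}}\big(E(a) \cap \ker \phi_b\big)$, where $E(a)$ is regarded as a subspace of $E(b)$ via the injective map $E(a \le b)$. The homology persistence module $H_d|F| : P \to \mathsf{Vec}$ sends $a$ to the singular homology $H_d(|F(a)|;\mathbb{F})$ of the underlying space of $F(a)$ and $a \le b$ to the map induced by the inclusion $|F(a)| \hookrightarrow |F(b)|$. *)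

theory Defs
  imports
    "HOL-Homology.Homology"
    "HOL-Library.Product_Order"
    "Jordan_Normal_Form.VS_Connect"
begin

section \<open>Posets and Moebius inversion\<close>

text \<open>
  A finite poset is a finite set \<^term>\<open>P\<close> of elements of a type of class \<^class>\<open>order\<close>.
  The interval $[a,b]$ is the pair \<^term>\<open>(a, b)\<close>; the order of \<^theory>\<open>HOL-Library.Product_Order\<close>
  is the componentwise one.
\<close>

definition intervals :: "'p::order set \<Rightarrow> ('p \<times> 'p) set" where
  "intervals P = {(a, b). a \<in> P \<and> b \<in> P \<and> a \<le> b}"

text \<open>Values outside \<^term>\<open>Q\<close> are normalised to \<open>0\<close> to make the inversion unique as a total function.\<close>

definition moebius_inversion :: "'q::order set \<Rightarrow> ('q \<Rightarrow> int) \<Rightarrow> 'q \<Rightarrow> int" where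
  "moebius_inversion Q m =
     (THE g. (\<forall>b\<in>Q. m b = (\<Sum>a | a \<in> Q \<and> a \<le> b. g a)) \<and> (\<forall>b. b \<notin> Q \<longrightarrow> g b = 0))"

lemma moebius_inversion_ex1:
  fixes Q :: "'q::order set"
  assumes fin: "finite Q"
  shows "\<exists>!g :: 'q \<Rightarrow> int. (\<forall>b\<in>Q. m b = (\<Sum>a | a \<in> Q \<and> a \<le> b. g a)) \<and> (\<forall>b. b \<notin> Q \<longrightarrow> g b = 0)"
proof -
  define R where "R = {(a, b). a \<in> Q \<and> b \<in> Q \<and> a < b}"
  have split: "(\<Sum>a | a \<in> Q \<and> a \<le> b. g a) = g b + (\<Sum>a | a \<in> Q \<and> a < b. g a)"
    if "b \<in> Q" for b and g :: "'q \<Rightarrow> int"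
  proof -
    have "{a. a \<in> Q \<and> a \<le> b} = insert b {a. a \<in> Q \<and> a < b}"
      using that by (auto simp: less_le)
    then show ?thesis using fin by simp
  qed
  have "R \<subseteq> Q \<times> Q" by (auto simp: R_def)
  then have finR: "finite R" using fin finite_subset by blast
  have "trans R" by (auto simp: R_def trans_def)
  then have "acyclic R"
    by (simp add: acyclic_irrefl) (auto simp: irrefl_def R_def)
  then have wf: "wf R" using finR finite_acyclic_wf by blast
  define G where "G g b = (if b \<in> Q then m b - (\<Sum>a | a \<in> Q \<and> a < b. g a) else 0)"
    for g :: "'q \<Rightarrow> int" and b
  define h where "h = wfrec R G"
  have h: "h b = G h b" for b
  proof -
    have "h b = G (cut h R b) b" unfolding h_def using wf by (rule wfrec)
    also have "\<dots> = G h b"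
      by (auto simp: G_def cut_def R_def intro!: sum.cong)
    finally show ?thesis .
  qed
  show ?thesis
  proof (intro ex1I[of _ h] conjI ballI allI impI)
    show "m b = (\<Sum>a | a \<in> Q \<and> a \<le> b. h a)" if "b \<in> Q" for b
      using h[of b] that by (simp add: split G_def)
    show "h b = 0" if "b \<notin> Q" for b
      using h[of b] that by (simp add: G_def)
  next
    fix g :: "'q \<Rightarrow> int"
    assume g: "(\<forall>b\<in>Q. m b = (\<Sum>a | a \<in> Q \<and> a \<le> b. g a)) \<and> (\<forall>b. b \<notin> Q \<longrightarrow> g b = 0)"
    have "g b = h b" for b
    proof (induction b rule: wf_induct_rule[OF wf])
      case (1 b)
      show ?case
      proof (cases "b \<in> Q")
        case True
        have "(\<Sum>a | a \<in> Q \<and> a < b. g a) = (\<Sum>a | a \<in> Q \<and> a < b. h a)"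
          using True 1 by (intro sum.cong) (auto simp: R_def)
        then show ?thesis
          using g True h[of b] split[OF True, of g] by (simp add: G_def)
      qed (use g h[of b] in \<open>simp add: G_def\<close>)
    qed
    then show "g = h" by blast
  qed
qed

text \<open>The relation \<open>m \<sim> n\<close> on integer functions on intervals: agreement off the diagonal.\<close>

definition interval_equiv :: "'p::order set \<Rightarrow> ('p \<times> 'p \<Rightarrow> int) \<Rightarrow> ('p \<times> 'p \<Rightarrow> int) \<Rightarrow> bool" where
  "interval_equiv P m n \<longleftrightarrow> (\<forall>a\<in>P. \<forall>b\<in>P. a < b \<longrightarrow> m (a, b) = n (a, b))"

section \<open>Vector spaces\<close>

text \<open>
  The coefficient field is a type of class \<^class>\<open>field\<close>; seen as the ring \<^term>\<open>class_ring\<close> it is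
  the scalar ring of carrier-based vector spaces, whose multiplicative ring fields \<^const>\<open>mult\<close> and
  \<^const>\<open>one\<close> play no role.
\<close>

definition free_vs :: "'b set \<Rightarrow> ('k::field, 'b \<Rightarrow>\<^sub>0 'k) module" where
  "free_vs B = \<lparr>carrier = {c. Poly_Mapping.keys c \<subseteq> B}, mult = undefined, one = undefined,
     zero = 0, add = (+), smult = (\<lambda>r. Poly_Mapping.map ((*) r))\<rparr>"

definition linear_extension :: "('b \<Rightarrow> ('c \<Rightarrow>\<^sub>0 'k)) \<Rightarrow> ('b \<Rightarrow>\<^sub>0 'k) \<Rightarrow> ('c \<Rightarrow>\<^sub>0 'k::field)" where
  "linear_extension g c =
     (\<Sum>x\<in>Poly_Mapping.keys c. Poly_Mapping.map ((*) (Poly_Mapping.lookup c x)) (g x))"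

definition quotient_vs :: "('k, 'm) module \<Rightarrow> 'm set \<Rightarrow> ('k, 'm set) module" where
  "quotient_vs V W = \<lparr>carrier = a_rcosets\<^bsub>V\<^esub> W, mult = undefined, one = undefined,
     zero = W, add = set_add V, smult = (\<lambda>r A. \<Union>x\<in>A. W +>\<^bsub>V\<^esub> (r \<odot>\<^bsub>V\<^esub> x))\<rparr>"

section \<open>Simplicial complexes, simplicial chains and filtrations\<close>

text \<open>
  A simplex is identified with its finite nonempty vertex set. The linear order on the vertex type
  orients the simplices in the chain complex.
\<close>

definition face_closed :: "'v set set \<Rightarrow> bool" where
  "face_closed A \<longleftrightarrow> (\<forall>\<sigma>\<in>A. \<forall>\<tau>. \<tau> \<subseteq> \<sigma> \<and> \<tau> \<noteq> {} \<longrightarrow> \<tau> \<in> A)"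

definition abstract_complex :: "'v set set \<Rightarrow> bool" where
  "abstract_complex K \<longleftrightarrow> (\<forall>\<sigma>\<in>K. finite \<sigma> \<and> \<sigma> \<noteq> {}) \<and> face_closed K"

definition subcomplexes :: "'v set set \<Rightarrow> 'v set set set" where
  "subcomplexes K = {A. A \<subseteq> K \<and> face_closed A}"

definition filtration :: "'p::order set \<Rightarrow> 'v set set \<Rightarrow> ('p \<Rightarrow> 'v set set) \<Rightarrow> bool" where
  "filtration P K F \<longleftrightarrow> F \<in> P \<rightarrow> subcomplexes K \<and> (\<forall>a\<in>P. \<forall>b\<in>P. a \<le> b \<longrightarrow> F a \<subseteq> F b)"

definition simplicial_chains :: "nat \<Rightarrow> 'v set set \<Rightarrow> ('k::field, 'v set \<Rightarrow>\<^sub>0 'k) module" where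
  "simplicial_chains d A = free_vs {\<sigma> \<in> A. card \<sigma> = Suc d}"

definition simplicial_boundary :: "nat \<Rightarrow> ('v::linorder set \<Rightarrow>\<^sub>0 'k) \<Rightarrow> ('v set \<Rightarrow>\<^sub>0 'k::field)" where
  "simplicial_boundary d c =
     (if d = 0 then 0
      else linear_extension
        (\<lambda>\<sigma>. \<Sum>i\<le>d. Poly_Mapping.single (\<sigma> - {sorted_list_of_set \<sigma> ! i}) ((-1) ^ i)) c)"

definition simplicial_cycles :: "nat \<Rightarrow> 'v::linorder set set \<Rightarrow> ('v set \<Rightarrow>\<^sub>0 'k::field) set" where
  "simplicial_cycles d A = {c \<in> carrier (simplicial_chains d A). simplicial_boundary d c = 0}"

definition simplicial_boundaries :: "nat \<Rightarrow> 'v::linorder set set \<Rightarrow> ('v set \<Rightarrow>\<^sub>0 'k::field) set" where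
  "simplicial_boundaries d A = simplicial_boundary (Suc d) ` carrier (simplicial_chains (Suc d) A)"

definition birth_death ::
  "'k::field itself \<Rightarrow> nat \<Rightarrow> ('p \<Rightarrow> 'v::linorder set set) \<Rightarrow> 'p \<times> 'p \<Rightarrow> int" where
  "birth_death _ d F = (\<lambda>(a, b). int (vectorspace.dim class_ring
     ((simplicial_chains d (F b) :: ('k, 'v set \<Rightarrow>\<^sub>0 'k) module)
        \<lparr>carrier := simplicial_cycles d (F a) \<inter> simplicial_boundaries d (F b)\<rparr>)))"

text \<open>
  The underlying space consists of barycentric coordinate functions. Its topology is that of the
  product \<open>\<real>\<^sup>V\<close>, as for \<^const>\<open>standard_simplex\<close>; for finite complexes this is the usual one.
\<close>

definition underlying_space :: "'v set set \<Rightarrow> ('v \<Rightarrow> real) topology" where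
  "underlying_space A = subtopology (powertop_real UNIV)
     {x. (\<forall>v. 0 \<le> x v) \<and> {v. x v \<noteq> 0} \<in> A \<and> (\<Sum>v | x v \<noteq> 0. x v) = 1}"

section \<open>Singular homology with field coefficients\<close>

text \<open>
  \<^theory>\<open>HOL-Homology.Homology\<close> has integer coefficients only; its singular simplices, faces and
  maps of simplices are used with the same sign convention.
\<close>

definition singular_chains :: "nat \<Rightarrow> 'a topology \<Rightarrow> ('k::field, ((nat \<Rightarrow> real) \<Rightarrow> 'a) \<Rightarrow>\<^sub>0 'k) module" where
  "singular_chains p X = free_vs (singular_simplex_set p X)"

definition singular_boundary ::
  "nat \<Rightarrow> (((nat \<Rightarrow> real) \<Rightarrow> 'a) \<Rightarrow>\<^sub>0 'k) \<Rightarrow> (((nat \<Rightarrow> real) \<Rightarrow> 'a) \<Rightarrow>\<^sub>0 'k::field)" where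
  "singular_boundary p c =
     (if p = 0 then 0
      else linear_extension
        (\<lambda>\<sigma>. \<Sum>i\<le>p. Poly_Mapping.single (singular_face p i \<sigma>) ((-1) ^ i)) c)"

definition singular_cycles :: "nat \<Rightarrow> 'a topology \<Rightarrow> (((nat \<Rightarrow> real) \<Rightarrow> 'a) \<Rightarrow>\<^sub>0 'k::field) set" where
  "singular_cycles p X = {c \<in> carrier (singular_chains p X). singular_boundary p c = 0}"

definition singular_boundaries :: "nat \<Rightarrow> 'a topology \<Rightarrow> (((nat \<Rightarrow> real) \<Rightarrow> 'a) \<Rightarrow>\<^sub>0 'k::field) set" where
  "singular_boundaries p X = singular_boundary (Suc p) ` carrier (singular_chains (Suc p) X)"

definition singular_homology ::
  "nat \<Rightarrow> 'a topology \<Rightarrow> ('k::field, (((nat \<Rightarrow> real) \<Rightarrow> 'a) \<Rightarrow>\<^sub>0 'k) set) module" where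
  "singular_homology p X =
     quotient_vs ((singular_chains p X)\<lparr>carrier := singular_cycles p X\<rparr>) (singular_boundaries p X)"

definition singular_chain_map ::
  "nat \<Rightarrow> ('a \<Rightarrow> 'b) \<Rightarrow> (((nat \<Rightarrow> real) \<Rightarrow> 'a) \<Rightarrow>\<^sub>0 'k) \<Rightarrow> (((nat \<Rightarrow> real) \<Rightarrow> 'b) \<Rightarrow>\<^sub>0 'k::field)" where
  "singular_chain_map p f = linear_extension (\<lambda>\<sigma>. Poly_Mapping.single (simplex_map p f \<sigma>) 1)"

text \<open>The map sending the class of a cycle \<open>c\<close> to the class of \<open>f\<^sub># c\<close> in the homology of \<open>Y\<close>.\<close>

definition homology_map ::
  "nat \<Rightarrow> 'b topology \<Rightarrow> ('a \<Rightarrow> 'b) \<Rightarrow> (((nat \<Rightarrow> real) \<Rightarrow> 'a) \<Rightarrow>\<^sub>0 'k) set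
     \<Rightarrow> (((nat \<Rightarrow> real) \<Rightarrow> 'b) \<Rightarrow>\<^sub>0 'k::field) set" where
  "homology_map p Y f A =
     (\<Union>c\<in>A. singular_boundaries p Y +>\<^bsub>singular_chains p Y\<^esub> singular_chain_map p f c)"

section \<open>Persistence modules\<close>

record ('p, 'k, 'm) persistence_data =
  obj :: "'p \<Rightarrow> ('k, 'm) module"
  arr :: "'p \<Rightarrow> 'p \<Rightarrow> 'm \<Rightarrow> 'm"

definition persistence_module :: "'p::order set \<Rightarrow> ('p, 'k::field, 'm) persistence_data \<Rightarrow> bool" where
  "persistence_module P M \<longleftrightarrow>
     (\<forall>a\<in>P. vectorspace class_ring (obj M a) \<and> vectorspace.fin_dim class_ring (obj M a)) \<and>
     (\<forall>a\<in>P. \<forall>b\<in>P. a \<le> b \<longrightarrow> linear_map class_ring (obj M a) (obj M b) (arr M a b)) \<and>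
     (\<forall>a\<in>P. \<forall>x\<in>carrier (obj M a). arr M a a x = x) \<and>
     (\<forall>a\<in>P. \<forall>b\<in>P. \<forall>c\<in>P. a \<le> b \<and> b \<le> c \<longrightarrow>
        (\<forall>x\<in>carrier (obj M a). arr M b c (arr M a b x) = arr M a c x))"

definition natural_transformation ::
  "'p::order set \<Rightarrow> ('p, 'k::field, 'm) persistence_data \<Rightarrow> ('p, 'k, 'n) persistence_data
     \<Rightarrow> ('p \<Rightarrow> 'm \<Rightarrow> 'n) \<Rightarrow> bool" where
  "natural_transformation P M N \<phi> \<longleftrightarrow>
     (\<forall>a\<in>P. linear_map class_ring (obj M a) (obj N a) (\<phi> a)) \<and>
     (\<forall>a\<in>P. \<forall>b\<in>P. a \<le> b \<longrightarrow>
        (\<forall>x\<in>carrier (obj M a). \<phi> b (arr M a b x) = arr N a b (\<phi> a x)))"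

definition isomorphic_modules ::
  "'p::order set \<Rightarrow> ('p, 'k::field, 'm) persistence_data \<Rightarrow> ('p, 'k, 'n) persistence_data \<Rightarrow> bool" where
  "isomorphic_modules P M N \<longleftrightarrow>
     (\<exists>\<phi>. natural_transformation P M N \<phi> \<and>
          (\<forall>a\<in>P. bij_betw (\<phi> a) (carrier (obj M a)) (carrier (obj N a))))"

definition principal_module :: "'p::order \<Rightarrow> ('p, 'k::field, 'k) persistence_data" where
  "principal_module a =
     \<lparr>obj = (\<lambda>b. \<lparr>carrier = (if a \<le> b then UNIV else {0}), mult = undefined, one = undefined,
               zero = 0, add = (+), smult = (*)\<rparr>),
      arr = (\<lambda>b c x. if a \<le> b then x else 0)\<rparr>"

definition direct_sum_module ::
  "'i set \<Rightarrow> ('i \<Rightarrow> ('p, 'k, 'm) persistence_data) \<Rightarrow> ('p, 'k, 'i \<Rightarrow> 'm) persistence_data" where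
  "direct_sum_module I N =
     \<lparr>obj = (\<lambda>b. \<lparr>carrier = {x \<in> \<Pi>\<^sub>E i\<in>I. carrier (obj (N i) b). finite {i \<in> I. x i \<noteq> \<zero>\<^bsub>obj (N i) b\<^esub>}},
               mult = undefined, one = undefined,
               zero = (\<lambda>i\<in>I. \<zero>\<^bsub>obj (N i) b\<^esub>),
               add = (\<lambda>x y. \<lambda>i\<in>I. x i \<oplus>\<^bsub>obj (N i) b\<^esub> y i),
               smult = (\<lambda>r x. \<lambda>i\<in>I. r \<odot>\<^bsub>obj (N i) b\<^esub> x i)\<rparr>),
      arr = (\<lambda>b c x. \<lambda>i\<in>I. arr (N i) b c (x i))\<rparr>"

text \<open>
  Index sets inside \<^typ>\<open>nat\<close> suffice: a direct sum of principal modules over the elements of a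
  finite poset has finite-dimensional values only if its index set is finite.
\<close>

definition free_module :: "'p::order set \<Rightarrow> ('p, 'k::field, 'm) persistence_data \<Rightarrow> bool" where
  "free_module P E \<longleftrightarrow> persistence_module P E \<and>
     (\<exists>(I :: nat set) g. g ` I \<subseteq> P \<and>
        isomorphic_modules P E (direct_sum_module I (\<lambda>i. principal_module (g i))))"

definition free_presentation ::
  "'p::order set \<Rightarrow> ('p, 'k::field, 'm) persistence_data \<Rightarrow> ('p, 'k, 'n) persistence_data
     \<Rightarrow> ('p \<Rightarrow> 'm \<Rightarrow> 'n) \<Rightarrow> bool" where
  "free_presentation P E M \<phi> \<longleftrightarrow>
     free_module P E \<and> natural_transformation P E M \<phi> \<and>
     (\<forall>a\<in>P. \<phi> a ` carrier (obj E a) = carrier (obj M a))"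

definition presentation_birth_death ::
  "('p, 'k::field, 'm) persistence_data \<Rightarrow> ('p, 'k, 'n) persistence_data
     \<Rightarrow> ('p \<Rightarrow> 'm \<Rightarrow> 'n) \<Rightarrow> 'p \<times> 'p \<Rightarrow> int" where
  "presentation_birth_death E M \<phi> = (\<lambda>(a, b). int (vectorspace.dim class_ring
     ((obj E b)\<lparr>carrier := arr E a b ` carrier (obj E a)
                             \<inter> mod_hom.ker (obj E b) (obj M b) (\<phi> b)\<rparr>)))"

definition homology_module ::
  "nat \<Rightarrow> ('p \<Rightarrow> 'v set set)
     \<Rightarrow> ('p, 'k::field, (((nat \<Rightarrow> real) \<Rightarrow> 'v \<Rightarrow> real) \<Rightarrow>\<^sub>0 'k) set) persistence_data" where
  "homology_module d F =
     \<lparr>obj = (\<lambda>a. singular_homology d (underlying_space (F a))),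
      arr = (\<lambda>a b. homology_map d (underlying_space (F b)) id)\<rparr>"

end

theory Submission
  imports Defs
begin

text \<open>
Fix $a \le b$. A cycle of $F(a)$ dies in the homology of $F(b)$ exactly when it is a boundary there,
and a vector of $E(a)$ dies exactly when it lies in the kernel of $\phi_b$. If simplicial and singular
homology are identified, both sides describe the same linear map $H_d(F(a)) \to H_d(F(b))$, and rank and
nullity give
$$\dim Z_d F(a) - ZB_d F[a,b] = \mathrm{rank} = \dim E(a) - ZB\phi[a,b].$$
Hence $ZB_d F[a,b] - ZB\phi[a,b]$ depends on $a$ only. The Moebius inversion of a function of $a$ alone
is concentrated on the intervals $[a,a]$, because $[c,c] \le [a,b]$ means $c \le a$; so the two
inversions agree off the diagonal.

The work is the identification of simplicial with singular homology for finite complexes, naturally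
for inclusions. It is made over the integers, with the method of acyclic carriers, and then transported
to the field by extending scalars. The carriers are: for a simplex, the closed simplex; for a small
singular simplex, either the simplex spanned by its \<^emph>\<open>corner vertices\<close> or the union of the closed
simplices whose interior meets its image. Here a vertex is attached to each point of a polyhedron by choosing a
largest barycentric coordinate, and a singular simplex is small if the vertices attached to its corners
have nonzero coordinates on its whole image. Iterated subdivision makes every chain small. Acyclicity
of the carriers comes from an algebraic cone over the least vertex on the simplicial side, and from a
straight-line contraction to a vertex on the singular side. Both chain maps are constructed on the
complex of all finite simplices and restrict to every subcomplex, which makes them natural for inclusions.
\<close>

section \<open>Acyclic carriers\<close>

text \<open>
The augmentation takes values in the free group on one point, so that it is itself an extension of a map
of basis elements and inherits the calculus of \<^const>\<open>frag_extend\<close>.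
\<close>

definition augmentation :: "('a \<Rightarrow>\<^sub>0 int) \<Rightarrow> (unit \<Rightarrow>\<^sub>0 int)" where
  "augmentation = frag_extend (\<lambda>_. frag_of ())"

lemma augmentation_diff: "augmentation (c - d) = augmentation c - augmentation d"
  by (simp add: augmentation_def frag_extend_diff)

lemma augmentation_of [simp]: "augmentation (frag_of x) = frag_of ()"
  by (simp add: augmentation_def)

lemma augmentation_0 [simp]: "augmentation 0 = 0"
  by (simp add: augmentation_def)

text \<open>
A chain of augmentation zero is killed by every map that is constant on the basis.
\<close>

lemma frag_extend_const_augmentation:
  "frag_extend (\<lambda>_. frag_of m) c = frag_extend (\<lambda>_. frag_of m) (augmentation c)"
  using subset_UNIV
  by (induction c rule: frag_induction) (auto simp: augmentation_diff frag_extend_diff)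

lemma additive_frag_extend:
  fixes h :: "('b \<Rightarrow>\<^sub>0 int) \<Rightarrow> ('c \<Rightarrow>\<^sub>0 int)"
  assumes diff: "\<And>c d. h (c - d) = h c - h d"
  shows "h (frag_extend g c) = frag_extend (\<lambda>x. h (g x)) c"
  using subset_UNIV
proof (induction c rule: frag_induction)
  case zero
  show ?case using diff[of 0 0] by simp
qed (auto simp: diff frag_extend_diff)

lemma frag_extend_extend:
  "frag_extend h (frag_extend g c) = frag_extend (\<lambda>x. frag_extend h (g x)) c"
  by (rule additive_frag_extend) (rule frag_extend_diff)

lemma frag_extend_diff_fun:
  "frag_extend (\<lambda>x. f x - g x) c = frag_extend f c - frag_extend g c"
  using subset_UNIV
  by (induction c rule: frag_induction) (auto simp: frag_extend_diff)

lemma additive_expansion: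
  assumes "\<And>c d. h (c - d) = h c - h d"
  shows "h c = frag_extend (\<lambda>x. h (frag_of x)) c"
  using additive_frag_extend[of h frag_of c] assms by (simp flip: frag_expansion)

lemma augmentation_frag_extend:
  assumes "\<And>x. x \<in> Poly_Mapping.keys c \<Longrightarrow> augmentation (f x) = frag_of ()"
  shows "augmentation (frag_extend f c) = augmentation c"
  by (simp add: additive_frag_extend[OF augmentation_diff] assms cong: frag_extend_eq)
    (simp add: augmentation_def)

text \<open>
A chain complex of free abelian groups with chosen bases. The operator \<open>bd p\<close> acts on all finite formal
sums and \<open>B p\<close> selects the complex in question, so that one singular boundary operator serves all spaces
and also the small simplices among the singular ones.
\<close>

locale based_complex =
  fixes B :: "nat \<Rightarrow> 'a set" and bd :: "nat \<Rightarrow> ('a \<Rightarrow>\<^sub>0 int) \<Rightarrow> ('a \<Rightarrow>\<^sub>0 int)"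
  assumes bd_diff: "bd p (c - d) = bd p c - bd p d"
    and bd_0: "bd 0 c = 0"
    and bd_closed: "x \<in> B (Suc p) \<Longrightarrow> Poly_Mapping.keys (bd (Suc p) (frag_of x)) \<subseteq> B p"
    and bd_bd: "x \<in> B (Suc (Suc p)) \<Longrightarrow> bd (Suc p) (bd (Suc (Suc p)) (frag_of x)) = 0"
    and aug_bd: "x \<in> B (Suc 0) \<Longrightarrow> augmentation (bd (Suc 0) (frag_of x)) = 0"
begin

lemma bd_extend: "bd p (frag_extend g c) = frag_extend (\<lambda>x. bd p (g x)) c"
  by (rule additive_frag_extend) (rule bd_diff)

lemma bd_expand: "bd p c = frag_extend (\<lambda>x. bd p (frag_of x)) c"
  by (rule additive_expansion) (rule bd_diff)

lemma bd_zero [simp]: "bd p 0 = 0"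
  using bd_diff[of p 0 0] by simp

lemma bd_bd_of:
  assumes "x \<in> B (Suc p)"
  shows "bd p (bd (Suc p) (frag_of x)) = 0"
  using assms bd_bd[of x "p - 1"] by (cases p) (auto simp: bd_0)

end

text \<open>
Vanishing of the reduced homology of the complex that is spanned by the bases \<open>T\<close>.
\<close>

definition acyclic_bases ::
  "(nat \<Rightarrow> ('a \<Rightarrow>\<^sub>0 int) \<Rightarrow> ('a \<Rightarrow>\<^sub>0 int)) \<Rightarrow> (nat \<Rightarrow> 'a set) \<Rightarrow> bool" where
  "acyclic_bases bd T \<longleftrightarrow>
     (\<forall>p z. Poly_Mapping.keys z \<subseteq> T p \<and> bd p z = 0 \<and> (p = 0 \<longrightarrow> augmentation z = 0) \<longrightarrow>
        (\<exists>w. Poly_Mapping.keys w \<subseteq> T (Suc p) \<and> bd (Suc p) w = z))"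

lemma acyclic_basesD:
  assumes "acyclic_bases bd T" "Poly_Mapping.keys z \<subseteq> T p" "bd p z = 0"
    "p = 0 \<Longrightarrow> augmentation z = 0"
  shows "\<exists>w. Poly_Mapping.keys w \<subseteq> T (Suc p) \<and> bd (Suc p) w = z"
  using assms unfolding acyclic_bases_def by blast

lemma keys_frag_extend_subset:
  assumes "\<And>x. x \<in> Poly_Mapping.keys c \<Longrightarrow> Poly_Mapping.keys (f x) \<subseteq> T"
  shows "Poly_Mapping.keys (frag_extend f c) \<subseteq> T"
  using keys_frag_extend[of f c] assms by blast

lemma keys_diff_subset:
  assumes "Poly_Mapping.keys a \<subseteq> T" "Poly_Mapping.keys b \<subseteq> T"
  shows "Poly_Mapping.keys (a - b :: 'a \<Rightarrow>\<^sub>0 int) \<subseteq> T"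
  using keys_diff[of a b] assms by blast

text \<open>
A carrier assigns to each basis element of the source an acyclic subcomplex of the target, given by its
bases, that grows when passing from a face to the whole element.
\<close>

locale carried_complexes = S: based_complex A bdA + T: based_complex B bdB
  for A :: "nat \<Rightarrow> 'a set" and bdA and B :: "nat \<Rightarrow> 'b set" and bdB +
  fixes \<Phi> :: "nat \<Rightarrow> 'a \<Rightarrow> nat \<Rightarrow> 'b set"
  assumes carrier_acyclic: "x \<in> A p \<Longrightarrow> acyclic_bases bdB (\<Phi> p x)"
    and carrier_mono:
      "x \<in> A (Suc p) \<Longrightarrow> y \<in> Poly_Mapping.keys (bdA (Suc p) (frag_of x)) \<Longrightarrow> \<Phi> p y q \<subseteq> \<Phi> (Suc p) x q"
begin

text \<open>
In degree \<open>0\<close> the term \<open>p - 1\<close> is harmless, since the boundary operators vanish there.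
\<close>

definition carried_chain_map :: "(nat \<Rightarrow> 'a \<Rightarrow> ('b \<Rightarrow>\<^sub>0 int)) \<Rightarrow> bool" where
  "carried_chain_map f \<longleftrightarrow> (\<forall>p. \<forall>x\<in>A p.
     Poly_Mapping.keys (f p x) \<subseteq> \<Phi> p x p \<and>
     bdB p (f p x) = frag_extend (f (p - 1)) (bdA p (frag_of x)) \<and>
     (p = 0 \<longrightarrow> augmentation (f p x) = frag_of ()))"

text \<open>
The value on a basis element is chosen by recursion on the degree: the image of its boundary is a cycle
in an acyclic carrier, hence a boundary there. In degree one the cycle has augmentation zero because
degree-zero values preserve the augmentation.
\<close>

lemma carried_chain_map_exists:
  assumes f0: "\<And>x. x \<in> A 0 \<Longrightarrow> Poly_Mapping.keys (f0 x) \<subseteq> \<Phi> 0 x 0"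
    and aug: "\<And>x. x \<in> A 0 \<Longrightarrow> augmentation (f0 x) = frag_of ()"
  shows "\<exists>f. f 0 = f0 \<and> carried_chain_map f"
proof -
  define f where "f = rec_nat f0 (\<lambda>p fp x. SOME w. Poly_Mapping.keys w \<subseteq> \<Phi> (Suc p) x (Suc p) \<and>
     bdB (Suc p) w = frag_extend fp (bdA (Suc p) (frag_of x)))"
  have f_0: "f 0 = f0" by (simp add: f_def)
  have f_Suc: "f (Suc p) x = (SOME w. Poly_Mapping.keys w \<subseteq> \<Phi> (Suc p) x (Suc p) \<and>
     bdB (Suc p) w = frag_extend (f p) (bdA (Suc p) (frag_of x)))" for p x
    by (simp add: f_def)
  have "\<forall>x\<in>A p. Poly_Mapping.keys (f p x) \<subseteq> \<Phi> p x p \<and>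
     bdB p (f p x) = frag_extend (f (p - 1)) (bdA p (frag_of x)) \<and>
     (p = 0 \<longrightarrow> augmentation (f p x) = frag_of ())" for p
  proof (induction p)
    case 0
    show ?case by (simp add: f_0 f0 aug S.bd_0 T.bd_0)
  next
    case (Suc p)
    show ?case
    proof
      fix x assume x: "x \<in> A (Suc p)"
      let ?b = "bdA (Suc p) (frag_of x)"
      let ?z = "frag_extend (f p) ?b"
      have b: "Poly_Mapping.keys ?b \<subseteq> A p" using S.bd_closed[OF x] .
      have "Poly_Mapping.keys ?z \<subseteq> \<Phi> (Suc p) x p"
        using Suc.IH b carrier_mono[OF x] by (intro keys_frag_extend_subset) blast
      moreover have "bdB p ?z = 0"
      proof -
        have "bdB p ?z = frag_extend (\<lambda>y. frag_extend (f (p - 1)) (bdA p (frag_of y))) ?b"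
          unfolding T.bd_extend using Suc.IH b by (intro frag_extend_eq) blast
        also have "\<dots> = frag_extend (f (p - 1)) (bdA p ?b)"
          by (simp add: frag_extend_extend S.bd_expand[of p ?b])
        finally show ?thesis using S.bd_bd_of[OF x] by simp
      qed
      moreover have "augmentation ?z = 0" if "p = 0"
        using that S.aug_bd x Suc.IH b by (subst augmentation_frag_extend) auto
      ultimately have "\<exists>w. Poly_Mapping.keys w \<subseteq> \<Phi> (Suc p) x (Suc p) \<and> bdB (Suc p) w = ?z"
        using acyclic_basesD[OF carrier_acyclic[OF x]] by blast
      from someI_ex[OF this]
      show "Poly_Mapping.keys (f (Suc p) x) \<subseteq> \<Phi> (Suc p) x (Suc p) \<and>
          bdB (Suc p) (f (Suc p) x) = frag_extend (f (Suc p - 1)) ?b \<and>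
          (Suc p = 0 \<longrightarrow> augmentation (f (Suc p) x) = frag_of ())"
        by (simp add: f_Suc)
    qed
  qed
  then show ?thesis using f_0 unfolding carried_chain_map_def by blast
qed

lemma carried_chain_map_chain:
  assumes f: "carried_chain_map f" and c: "Poly_Mapping.keys c \<subseteq> A p"
  shows "bdB p (frag_extend (f p) c) = frag_extend (f (p - 1)) (bdA p c)"
proof -
  have "bdB p (frag_extend (f p) c) = frag_extend (\<lambda>x. frag_extend (f (p - 1)) (bdA p (frag_of x))) c"
    unfolding T.bd_extend using f c unfolding carried_chain_map_def by (intro frag_extend_eq) blast
  then show ?thesis by (simp add: frag_extend_extend S.bd_expand[of p c])
qed

lemma carried_chain_map_augmentation:
  assumes f: "carried_chain_map f" and c: "Poly_Mapping.keys c \<subseteq> A 0"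
  shows "augmentation (frag_extend (f 0) c) = augmentation c"
  using f c unfolding carried_chain_map_def by (intro augmentation_frag_extend) blast

text \<open>
Two chain maps with the same carrier are homotopic through a homotopy with that carrier: the obstruction
\<open>f - g - h \<circ> \<partial>\<close> is again a cycle in an acyclic carrier.
\<close>

lemma carried_homotopy_exists:
  assumes f: "carried_chain_map f" and g: "carried_chain_map g"
  shows "\<exists>h. \<forall>p. \<forall>x\<in>A p. Poly_Mapping.keys (h p x) \<subseteq> \<Phi> p x (Suc p) \<and>
     bdB (Suc p) (h p x) = f p x - g p x - frag_extend (h (p - 1)) (bdA p (frag_of x))"
proof -
  have fgE: "Poly_Mapping.keys (e p x) \<subseteq> \<Phi> p x p"
    "bdB p (e p x) = frag_extend (e (p - 1)) (bdA p (frag_of x))"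
    "p = 0 \<Longrightarrow> augmentation (e p x) = frag_of ()"
    if "x \<in> A p" "e = f \<or> e = g" for e p x
    using that f g unfolding carried_chain_map_def by blast+
  define h where "h = rec_nat
     (\<lambda>x. SOME w. Poly_Mapping.keys w \<subseteq> \<Phi> 0 x (Suc 0) \<and> bdB (Suc 0) w = f 0 x - g 0 x)
     (\<lambda>p hp x. SOME w. Poly_Mapping.keys w \<subseteq> \<Phi> (Suc p) x (Suc (Suc p)) \<and>
     bdB (Suc (Suc p)) w = f (Suc p) x - g (Suc p) x - frag_extend hp (bdA (Suc p) (frag_of x)))"
  have h_0: "h 0 x = (SOME w. Poly_Mapping.keys w \<subseteq> \<Phi> 0 x (Suc 0) \<and> bdB (Suc 0) w = f 0 x - g 0 x)" for x
    by (simp add: h_def)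
  have h_Suc: "h (Suc p) x = (SOME w. Poly_Mapping.keys w \<subseteq> \<Phi> (Suc p) x (Suc (Suc p)) \<and>
     bdB (Suc (Suc p)) w = f (Suc p) x - g (Suc p) x - frag_extend (h p) (bdA (Suc p) (frag_of x)))" for p x
    by (simp add: h_def)
  have "\<forall>x\<in>A p. Poly_Mapping.keys (h p x) \<subseteq> \<Phi> p x (Suc p) \<and>
     bdB (Suc p) (h p x) = f p x - g p x - frag_extend (h (p - 1)) (bdA p (frag_of x))" for p
  proof (induction p)
    case 0
    show ?case
    proof
      fix x assume x: "x \<in> A 0"
      have "\<exists>w. Poly_Mapping.keys w \<subseteq> \<Phi> 0 x (Suc 0) \<and> bdB (Suc 0) w = f 0 x - g 0 x"
        using x by (intro acyclic_basesD[OF carrier_acyclic[OF x]] keys_diff_subset)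
          (auto simp: fgE T.bd_0 augmentation_diff dest: fgE(1)[THEN subsetD])
      from someI_ex[OF this]
      show "Poly_Mapping.keys (h 0 x) \<subseteq> \<Phi> 0 x (Suc 0) \<and>
        bdB (Suc 0) (h 0 x) = f 0 x - g 0 x - frag_extend (h (0 - 1)) (bdA 0 (frag_of x))"
        by (simp add: h_0 S.bd_0)
    qed
  next
    case (Suc p)
    show ?case
    proof
      fix x assume x: "x \<in> A (Suc p)"
      let ?b = "bdA (Suc p) (frag_of x)"
      let ?z = "f (Suc p) x - g (Suc p) x - frag_extend (h p) ?b"
      have b: "Poly_Mapping.keys ?b \<subseteq> A p" using S.bd_closed[OF x] .
      have "Poly_Mapping.keys (frag_extend (h p) ?b) \<subseteq> \<Phi> (Suc p) x (Suc p)"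
        using Suc.IH b carrier_mono[OF x] by (intro keys_frag_extend_subset) blast
      then have "Poly_Mapping.keys ?z \<subseteq> \<Phi> (Suc p) x (Suc p)"
        using fgE(1)[OF x] by (intro keys_diff_subset) auto
      moreover have "bdB (Suc p) ?z = 0"
      proof -
        have "bdB (Suc p) (frag_extend (h p) ?b) =
            frag_extend (\<lambda>y. f p y - g p y - frag_extend (h (p - 1)) (bdA p (frag_of y))) ?b"
          unfolding T.bd_extend using Suc.IH b by (intro frag_extend_eq) blast
        also have "\<dots> = frag_extend (f p) ?b - frag_extend (g p) ?b
            - frag_extend (h (p - 1)) (bdA p ?b)"
          by (simp add: frag_extend_diff_fun frag_extend_extend S.bd_expand[of p ?b])
        finally show ?thesis
          using S.bd_bd_of[OF x] fgE(2)[OF x] by (simp add: T.bd_diff)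
      qed
      ultimately have "\<exists>w. Poly_Mapping.keys w \<subseteq> \<Phi> (Suc p) x (Suc (Suc p)) \<and> bdB (Suc (Suc p)) w = ?z"
        using acyclic_basesD[OF carrier_acyclic[OF x]] by blast
      from someI_ex[OF this]
      show "Poly_Mapping.keys (h (Suc p) x) \<subseteq> \<Phi> (Suc p) x (Suc (Suc p)) \<and>
          bdB (Suc (Suc p)) (h (Suc p) x) = f (Suc p) x - g (Suc p) x - frag_extend (h (Suc p - 1)) ?b"
        by (simp add: h_Suc)
    qed
  qed
  then show ?thesis by blast
qed

end

section \<open>The integral simplicial chain complex\<close>

text \<open>
The integral counterpart of \<^const>\<open>simplicial_boundary\<close>.
\<close>

definition simplex_boundary :: "nat \<Rightarrow> ('v::linorder set \<Rightarrow>\<^sub>0 int) \<Rightarrow> ('v set \<Rightarrow>\<^sub>0 int)" where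
  "simplex_boundary p c =
     (if p = 0 then 0
      else frag_extend
        (\<lambda>\<sigma>. \<Sum>i\<le>p. frag_cmul ((-1) ^ i) (frag_of (\<sigma> - {sorted_list_of_set \<sigma> ! i}))) c)"

abbreviation simplices :: "'v set set \<Rightarrow> nat \<Rightarrow> 'v set set" where
  "simplices A p \<equiv> {\<sigma> \<in> A. card \<sigma> = Suc p}"

abbreviation faces :: "'v set \<Rightarrow> 'v set set" where
  "faces \<sigma> \<equiv> {\<tau>. \<tau> \<subseteq> \<sigma> \<and> \<tau> \<noteq> {}}"

lemma simplex_boundary_diff: "simplex_boundary p (c - d) = simplex_boundary p c - simplex_boundary p d"
  by (simp add: simplex_boundary_def frag_extend_diff)

lemma simplex_boundary_extend:
  "simplex_boundary p (frag_extend g c) = frag_extend (\<lambda>x. simplex_boundary p (g x)) c"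
  by (rule additive_frag_extend) (rule simplex_boundary_diff)

lemma simplex_boundary_expand:
  "simplex_boundary p c = frag_extend (\<lambda>x. simplex_boundary p (frag_of x)) c"
  by (rule additive_expansion) (rule simplex_boundary_diff)

lemma simplex_boundary_of:
  "p \<noteq> 0 \<Longrightarrow> simplex_boundary p (frag_of \<sigma>) =
     (\<Sum>i\<le>p. frag_cmul ((-1) ^ i) (frag_of (\<sigma> - {sorted_list_of_set \<sigma> ! i})))"
  by (simp add: simplex_boundary_def)

lemma keys_simplex_boundary:
  assumes "card \<sigma> = Suc (Suc p)" "\<tau> \<in> Poly_Mapping.keys (simplex_boundary (Suc p) (frag_of \<sigma>))"
  shows "\<tau> \<subseteq> \<sigma> \<and> card \<tau> = Suc p"
proof -
  have fin: "finite \<sigma>" using assms(1) card.infinite by fastforce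
  have "\<tau> \<in> (\<Union>i\<in>{..Suc p}. {\<sigma> - {sorted_list_of_set \<sigma> ! i}})"
    using assms(2) keys_sum[of "\<lambda>i. frag_cmul ((-1) ^ i) (frag_of (\<sigma> - {sorted_list_of_set \<sigma> ! i}))" "{..Suc p}"]
    by (force simp: simplex_boundary_of simp del: sum.atMost_Suc)
  then obtain i where i: "i \<le> Suc p" "\<tau> = \<sigma> - {sorted_list_of_set \<sigma> ! i}" by auto
  have "sorted_list_of_set \<sigma> ! i \<in> \<sigma>"
    using i(1) assms(1) fin by (metis le_imp_less_Suc length_sorted_list_of_set nth_mem set_sorted_list_of_set)
  then show ?thesis using i fin assms(1) by auto
qed

text \<open>
The algebraic cone with apex \<open>m\<close>. For \<open>m\<close> below all vertices of the simplex, the apex comes first in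
the ordering of the joined simplex, so no sign occurs; a simplex that already contains the apex would
become degenerate and is sent to zero.
\<close>

definition vertex_join :: "'v \<Rightarrow> 'v set \<Rightarrow> ('v set \<Rightarrow>\<^sub>0 int)" where
  "vertex_join m \<tau> = (if m \<in> \<tau> then 0 else frag_of (insert m \<tau>))"

text \<open>
If \<open>m\<close> is a new vertex, removing it gives back \<open>\<tau>\<close>, and removing another vertex gives the join with a
face of \<open>\<tau>\<close>, with the sign shifted by one position. If \<open>m\<close> is already the first vertex of \<open>\<tau>\<close>, the only
face of \<open>\<tau>\<close> whose join survives is the one opposite to \<open>m\<close>, and its join is \<open>\<tau>\<close>.
\<close>

lemma simplex_boundary_vertex_join_of:
  fixes \<tau> :: "'v::linorder set"
  assumes card: "card \<tau> = Suc p" and m: "\<And>v. v \<in> \<tau> \<Longrightarrow> m \<le> v"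
  shows "simplex_boundary (Suc p) (vertex_join m \<tau>) = frag_of \<tau> -
    (if p = 0 then frag_of {m} else frag_extend (vertex_join m) (simplex_boundary p (frag_of \<tau>)))"
proof -
  define l where "l = sorted_list_of_set \<tau>"
  have fin: "finite \<tau>" using card card.infinite by fastforce
  have len: "length l = Suc p" and set: "set l = \<tau>" and dist: "distinct l" and sorted: "sorted l"
    using card fin by (auto simp: l_def)
  have bd: "frag_extend (vertex_join m) (simplex_boundary p (frag_of \<tau>)) =
      (\<Sum>i\<le>p. frag_cmul ((-1) ^ i) (vertex_join m (\<tau> - {l ! i})))" if "p \<noteq> 0"
    using that by (simp add: simplex_boundary_of frag_extend_sum frag_extend_cmul l_def)
  show ?thesis
  proof (cases "m \<in> \<tau>")
    case False
    have li: "l ! i \<noteq> m" if "i \<le> p" for i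
      using that len set False by (metis le_imp_less_Suc nth_mem)
    have sl: "sorted_list_of_set (insert m \<tau>) = m # l"
      unfolding l_def using fin False m
      by (auto simp: sorted_list_of_set_insert insort_is_Cons)
    have faces: "insert m \<tau> - {l ! i} = insert m (\<tau> - {l ! i})" if "i \<le> p" for i
      using li[OF that] by auto
    have "simplex_boundary (Suc p) (vertex_join m \<tau>) =
        (\<Sum>i\<le>Suc p. frag_cmul ((-1) ^ i) (frag_of (insert m \<tau> - {(m # l) ! i})))"
      using False by (simp add: vertex_join_def simplex_boundary_of sl del: sum.atMost_Suc)
    also have "\<dots> = frag_of \<tau> +
        (\<Sum>i\<le>p. frag_cmul ((-1) ^ Suc i) (frag_of (insert m \<tau> - {l ! i})))"
      using False by (simp add: sum.atMost_Suc_shift del: sum.atMost_Suc)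
    also have "(\<Sum>i\<le>p. frag_cmul ((-1) ^ Suc i) (frag_of (insert m \<tau> - {l ! i}))) =
        - (\<Sum>i\<le>p. frag_cmul ((-1) ^ i) (frag_of (insert m (\<tau> - {l ! i}))))"
      by (simp add: sum_negf[symmetric] faces)
    also have "(\<Sum>i\<le>p. frag_cmul ((-1) ^ i) (frag_of (insert m (\<tau> - {l ! i})))) =
      (if p = 0 then frag_of {m} else frag_extend (vertex_join m) (simplex_boundary p (frag_of \<tau>)))"
    proof (cases "p = 0")
      case True
      then have "\<tau> = {l ! 0}" using len set by (cases l) auto
      then have "\<tau> - {l ! 0} = {}" by auto
      then have "frag_of (insert m (\<tau> - {l ! 0})) = frag_of {m}" by (metis Diff_cancel)
      then show ?thesis using True by simp
    next
      case p: False
      then show ?thesis using False by (simp add: bd) (simp add: vertex_join_def)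
    qed
    finally show ?thesis by simp
  next
    case True
    have "l ! 0 = m"
    proof -
      obtain i where i: "i < length l" "l ! i = m" using True set by (metis in_set_conv_nth)
      then have "l ! 0 \<le> m" using sorted by (metis le0 sorted_nth_mono)
      moreover have "m \<le> l ! 0" using m len set by (metis nth_mem zero_less_Suc)
      ultimately show ?thesis by simp
    qed
    then have l0: "m = l ! 0" ..
    have rest: "m \<in> \<tau> - {l ! i}" if "i \<le> p" "i \<noteq> 0" for i
      using that True dist len unfolding l0 by (simp add: nth_eq_iff_index_eq)
    show ?thesis
    proof (cases "p = 0")
      case p: True
      then have "\<tau> = {l ! 0}" using len set by (cases l) auto
      then show ?thesis using p True by (simp add: vertex_join_def simplex_boundary_def l0)
    next
      case p: False
      have "(\<Sum>i\<le>p. frag_cmul ((-1) ^ i) (vertex_join m (\<tau> - {l ! i}))) =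
          (\<Sum>i\<in>{0::nat}. frag_cmul ((-1) ^ i) (vertex_join m (\<tau> - {l ! i})))"
        by (rule sum.mono_neutral_right) (auto simp: vertex_join_def dest: rest)
      also have "\<dots> = frag_of \<tau>"
        using True by (simp add: vertex_join_def l0 insert_absorb)
      finally show ?thesis using p True by (simp add: bd) (simp add: vertex_join_def simplex_boundary_def)
    qed
  qed
qed

lemma simplex_boundary_vertex_join:
  fixes c :: "'v::linorder set \<Rightarrow>\<^sub>0 int"
  assumes "\<And>\<tau>. \<tau> \<in> Poly_Mapping.keys c \<Longrightarrow> card \<tau> = Suc p \<and> (\<forall>v\<in>\<tau>. m \<le> v)"
  shows "simplex_boundary (Suc p) (frag_extend (vertex_join m) c) =
    c - (if p = 0 then frag_extend (\<lambda>_. frag_of {m}) (augmentation c)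
         else frag_extend (vertex_join m) (simplex_boundary p c))"
proof -
  have "simplex_boundary (Suc p) (frag_extend (vertex_join m) c) =
    frag_extend (\<lambda>\<tau>. frag_of \<tau> - (if p = 0 then frag_of {m}
       else frag_extend (vertex_join m) (simplex_boundary p (frag_of \<tau>)))) c"
    unfolding simplex_boundary_extend using assms
    by (intro frag_extend_eq simplex_boundary_vertex_join_of) auto
  also have "\<dots> = c - (if p = 0 then frag_extend (\<lambda>_. frag_of {m}) (augmentation c)
         else frag_extend (vertex_join m) (simplex_boundary p c))"
    by (simp add: frag_extend_diff_fun flip: frag_expansion frag_extend_const_augmentation)
      (simp add: frag_extend_extend simplex_boundary_expand[of p c])
  finally show ?thesis .
qed

lemma augmentation_simplex_boundary: "augmentation (simplex_boundary (Suc 0) c) = 0"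
proof -
  have "augmentation (simplex_boundary (Suc 0) (frag_of x)) = 0" for x :: "'a::linorder set"
    by (simp add: simplex_boundary_of augmentation_diff)
  then show ?thesis
    by (subst simplex_boundary_expand) (simp add: additive_frag_extend[OF augmentation_diff] frag_extend_eq_0)
qed

text \<open>
Every simplex is the join of its least vertex with the opposite face, so the identity for joins reduces
the claim to a simplex with one vertex less.
\<close>

lemma simplex_boundary_boundary:
  fixes \<sigma> :: "'v::linorder set"
  assumes "card \<sigma> = Suc (Suc (Suc p))"
  shows "simplex_boundary (Suc p) (simplex_boundary (Suc (Suc p)) (frag_of \<sigma>)) = 0"
  using assms
proof (induction p arbitrary: \<sigma>)
  case (0 \<sigma>)
  define m where "m = Min \<sigma>"
  have fin: "finite \<sigma>" using 0 card.infinite by fastforce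
  have m: "m \<in> \<sigma>" "\<And>v. v \<in> \<sigma> \<Longrightarrow> m \<le> v" using fin 0 by (auto simp: m_def intro!: Min_in)
  let ?\<tau> = "\<sigma> - {m}"
  have card: "card ?\<tau> = Suc (Suc 0)" using 0 m fin by simp
  have \<sigma>: "frag_of \<sigma> = vertex_join m ?\<tau>" using m by (simp add: vertex_join_def insert_absorb)
  have "simplex_boundary (Suc (Suc 0)) (frag_of \<sigma>) =
    frag_of ?\<tau> - frag_extend (vertex_join m) (simplex_boundary (Suc 0) (frag_of ?\<tau>))"
    unfolding \<sigma> using card m by (subst simplex_boundary_vertex_join_of) auto
  moreover have "simplex_boundary (Suc 0)
      (frag_extend (vertex_join m) (simplex_boundary (Suc 0) (frag_of ?\<tau>))) =
      simplex_boundary (Suc 0) (frag_of ?\<tau>)"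
    using keys_simplex_boundary[OF card] m
    by (subst simplex_boundary_vertex_join) (auto simp: augmentation_simplex_boundary)
  ultimately show ?case by (simp add: simplex_boundary_diff)
next
  case (Suc p \<sigma>)
  define m where "m = Min \<sigma>"
  have fin: "finite \<sigma>" using Suc.prems card.infinite by fastforce
  have m: "m \<in> \<sigma>" "\<And>v. v \<in> \<sigma> \<Longrightarrow> m \<le> v" using fin Suc.prems by (auto simp: m_def intro!: Min_in)
  let ?\<tau> = "\<sigma> - {m}"
  have card: "card ?\<tau> = Suc (Suc (Suc p))" using Suc.prems m fin by simp
  have \<sigma>: "frag_of \<sigma> = vertex_join m ?\<tau>" using m by (simp add: vertex_join_def insert_absorb)
  have "simplex_boundary (Suc (Suc (Suc p))) (frag_of \<sigma>) =
    frag_of ?\<tau> - frag_extend (vertex_join m) (simplex_boundary (Suc (Suc p)) (frag_of ?\<tau>))"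
    unfolding \<sigma> using card m by (subst simplex_boundary_vertex_join_of) auto
  moreover have "simplex_boundary (Suc (Suc p))
      (frag_extend (vertex_join m) (simplex_boundary (Suc (Suc p)) (frag_of ?\<tau>))) =
      simplex_boundary (Suc (Suc p)) (frag_of ?\<tau>)"
    using keys_simplex_boundary[OF card] m Suc.IH[OF card]
    by (subst simplex_boundary_vertex_join) auto
  ultimately show ?case by (simp add: simplex_boundary_diff)
qed

lemma simplicial_based_complex:
  assumes "face_closed A"
  shows "based_complex (simplices A) simplex_boundary"
proof
  show "Poly_Mapping.keys (simplex_boundary (Suc p) (frag_of x)) \<subseteq> simplices A p"
    if "x \<in> simplices A (Suc p)" for p x
  proof
    fix \<tau> assume "\<tau> \<in> Poly_Mapping.keys (simplex_boundary (Suc p) (frag_of x))"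
    then have "\<tau> \<subseteq> x" "card \<tau> = Suc p" using that keys_simplex_boundary by auto
    moreover have "\<tau> \<noteq> {}" using \<open>card \<tau> = Suc p\<close> by auto
    ultimately show "\<tau> \<in> simplices A p" using assms that unfolding face_closed_def by auto
  qed
qed (auto simp: simplex_boundary_diff simplex_boundary_boundary augmentation_simplex_boundary,
  simp add: simplex_boundary_def)

text \<open>
Joining with the least vertex contracts the closed simplex.
\<close>

lemma acyclic_simplex:
  fixes \<sigma> :: "'v::linorder set"
  assumes fin: "finite \<sigma>" "\<sigma> \<noteq> {}"
  shows "acyclic_bases simplex_boundary (simplices (faces \<sigma>))"
  unfolding acyclic_bases_def
proof (intro allI impI, elim conjE)
  fix p and z :: "'v set \<Rightarrow>\<^sub>0 int"
  assume z: "Poly_Mapping.keys z \<subseteq> simplices (faces \<sigma>) p" "simplex_boundary p z = 0"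
    and aug: "p = 0 \<longrightarrow> augmentation z = 0"
  let ?w = "frag_extend (vertex_join (Min \<sigma>)) z"
  have "simplex_boundary (Suc p) ?w = z"
    using z aug fin Min_le[OF fin(1)]
    by (subst simplex_boundary_vertex_join) (auto simp: subset_iff split: if_splits)
  moreover have "Poly_Mapping.keys ?w \<subseteq> simplices (faces \<sigma>) (Suc p)"
  proof (rule keys_frag_extend_subset)
    fix \<tau> assume "\<tau> \<in> Poly_Mapping.keys z"
    then have \<tau>: "\<tau> \<subseteq> \<sigma>" "card \<tau> = Suc p" using z by auto
    then have "finite \<tau>" using fin finite_subset by blast
    then show "Poly_Mapping.keys (vertex_join (Min \<sigma>) \<tau>) \<subseteq> simplices (faces \<sigma>) (Suc p)"
      using \<tau> fin by (auto simp: vertex_join_def)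
  qed
  ultimately show "\<exists>w. Poly_Mapping.keys w \<subseteq> simplices (faces \<sigma>) (Suc p) \<and> simplex_boundary (Suc p) w = z"
    by blast
qed

section \<open>Singular chains of contractible polyhedra\<close>

lemma singular_based_complex:
  "based_complex (\<lambda>p. singular_simplex_set p X) chain_boundary"
proof
  show "Poly_Mapping.keys (chain_boundary (Suc p) (frag_of x)) \<subseteq> singular_simplex_set p X"
    if "x \<in> singular_simplex_set (Suc p) X" for p x
    using singular_chain_boundary_alt[of p X "frag_of x"] that
    by (simp add: singular_chain_of) (simp add: singular_chain_def)
  show "chain_boundary (Suc p) (chain_boundary (Suc (Suc p)) (frag_of x)) = 0"
    if "x \<in> singular_simplex_set (Suc (Suc p)) X" for p x
    using chain_boundary_boundary_alt[of "Suc p" X "frag_of x"] that by (simp add: singular_chain_of)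
qed (auto simp: chain_boundary_diff chain_boundary_of augmentation_diff, simp add: chain_boundary_def)

text \<open>
The identity is homotopic to a constant map, so a cycle is homologous to its image in a one-point space.
In positive degrees all cycles there bound; in degree zero the image is a multiple of one point, by the
augmentation of the cycle.
\<close>

lemma contractible_space_acyclic:
  assumes "contractible_space X"
  shows "acyclic_bases chain_boundary (\<lambda>p. singular_simplex_set p X)"
  unfolding acyclic_bases_def
proof (intro allI impI, elim conjE)
  fix p and z :: "'a chain"
  assume keys: "Poly_Mapping.keys z \<subseteq> singular_simplex_set p X"
    and cyc: "chain_boundary p z = 0" and aug: "p = 0 \<longrightarrow> augmentation z = 0"
  have chain: "singular_chain p X z" using keys by (simp add: singular_chain_def)
  then have z: "singular_relcycle p X {} z" using cyc by (simp add: singular_cycle)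
  show "\<exists>w. Poly_Mapping.keys w \<subseteq> singular_simplex_set (Suc p) X \<and> chain_boundary (Suc p) w = z"
  proof (cases "topspace X = {}")
    case True
    then have "z = 0" using chain singular_chain_empty by blast
    then show ?thesis by (intro exI[of _ 0]) simp
  next
    case False
    from assms obtain a where hom: "homotopic_with (\<lambda>x. True) X X id (\<lambda>x. a)"
      unfolding contractible_space_def by blast
    have cont: "continuous_map X X (\<lambda>x. a)"
      using homotopic_with_imp_continuous_maps[OF hom] by blast
    then have a: "a \<in> topspace X" using False by (auto simp: continuous_map_def)
    let ?c = "chain_map p (\<lambda>x. a) z"
    have "homologous_rel p X {} (chain_map p id z) ?c"
      using homotopic_imp_homologous_rel_chain_maps[of "{}" "{}" X X id "\<lambda>x. a" p z] hom z by simp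
    then have rel: "singular_relboundary p X {} (z - ?c)"
      using chain by (simp add: homologous_rel_def chain_map_ident)
    have c: "singular_relboundary p X {} ?c"
    proof (cases "p = 0")
      case True
      have "?c = frag_extend (\<lambda>_. frag_of (restrict (\<lambda>_. a) (standard_simplex 0))) z"
        using True by (simp add: chain_map_def simplex_map_def comp_def)
      also have "\<dots> = 0" using aug True by (subst frag_extend_const_augmentation) simp
      finally show ?thesis by simp
    next
      case False
      let ?Y = "subtopology X {a}"
      have "singular_relcycle p ?Y {} ?c"
        using z a by (intro singular_relcycle_chain_map[OF z]) (auto simp: continuous_map_in_subtopology cont)
      then have "singular_relboundary p ?Y {} ?c"
        using singular_boundary_eq_cycle_singleton[of ?Y a p ?c] a False by auto
      then show ?thesis
        using singular_boundary_mono[of "{a}" "topspace X" p X ?c] a by simp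
    qed
    have "singular_relboundary p X {} z" using singular_relboundary_add[OF rel c] by simp
    then show ?thesis by (auto simp: singular_boundary singular_chain_def)
  qed
qed

abbreviation support :: "('v \<Rightarrow> real) \<Rightarrow> 'v set" where
  "support x \<equiv> {v. x v \<noteq> 0}"

lemma topspace_underlying_space:
  "topspace (underlying_space A) =
     {x. (\<forall>v. 0 \<le> x v) \<and> support x \<in> A \<and> (\<Sum>v | x v \<noteq> 0. x v) = 1}"
  by (simp add: underlying_space_def)

lemma singular_simplex_underlying_space:
  "singular_simplex p (underlying_space A) f \<longleftrightarrow>
     singular_simplex p (powertop_real UNIV) f \<and>
     (\<forall>x\<in>standard_simplex p. f x \<in> topspace (underlying_space A))"
  unfolding underlying_space_def by (auto simp: singular_simplex_subtopology)

lemma singular_simplex_underlying_space_mono: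
  assumes "singular_simplex p (underlying_space A) f" "A \<subseteq> B"
  shows "singular_simplex p (underlying_space B) f"
  using assms unfolding singular_simplex_underlying_space topspace_underlying_space by auto

lemma singular_simplex_set_underlying_space_mono:
  assumes "A \<subseteq> B"
  shows "singular_simplex_set p (underlying_space A) \<subseteq> singular_simplex_set p (underlying_space B)"
  using singular_simplex_underlying_space_mono[OF _ assms] by auto

text \<open>
The straight line from a point \<open>x\<close> to the vertex \<open>v\<close> has support contained in \<open>insert v (support x)\<close>,
so it stays in the polyhedron.
\<close>

lemma contractible_underlying_space_cone:
  assumes L: "face_closed L" "\<And>\<tau>. \<tau> \<in> L \<Longrightarrow> finite \<tau>" "\<And>\<tau>. \<tau> \<in> L \<Longrightarrow> insert v \<tau> \<in> L"
  shows "contractible_space (underlying_space L)"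
proof (cases "L = {}")
  case True
  then have "topspace (underlying_space L) = {}" by (simp add: topspace_underlying_space)
  then have "underlying_space L = trivial_topology" by (rule null_topspace_iff_trivial[THEN iffD1])
  then show ?thesis by (simp only: contractible_space_empty)
next
  case False
  let ?X = "underlying_space L"
  define h :: "real \<times> ('a \<Rightarrow> real) \<Rightarrow> 'a \<Rightarrow> real" where
    "h = (\<lambda>z w. (1 - fst z) * snd z w + fst z * (if w = v then 1 else 0))"
  have v: "{v} \<in> L"
  proof -
    obtain \<tau> where "\<tau> \<in> L" using False by auto
    then have "insert v \<tau> \<in> L" by (rule L(3))
    then show ?thesis using L(1) unfolding face_closed_def by (metis empty_subsetI insert_mono insert_not_empty)
  qed
  have mem: "h (t, x) \<in> topspace ?X" if t: "0 \<le> t" "t \<le> 1" and x: "x \<in> topspace ?X" for t x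
  proof -
    have x': "\<And>w. 0 \<le> x w" "support x \<in> L" "(\<Sum>w\<in>support x. x w) = 1"
      using x by (auto simp: topspace_underlying_space)
    have fin: "finite (support x)" using x'(2) L(2) by blast
    let ?S = "insert v (support x)"
    have nn: "0 \<le> h (t, x) w" for w using t x'(1) by (simp add: h_def)
    have supp: "support (h (t, x)) \<in> L"
    proof (cases "t = 0 \<or> t = 1")
      case True
      then show ?thesis
      proof
        assume "t = 0"
        then show ?thesis using x'(2) by (simp add: h_def)
      next
        assume "t = 1"
        then have "support (h (t, x)) = {v}" by (auto simp: h_def)
        then show ?thesis using v by simp
      qed
    next
      case False
      then have "t < 1" "0 < t" using t by auto
      then have "h (t, x) w \<noteq> 0 \<longleftrightarrow> w \<in> ?S" for w
        using x'(1)[of w] by (auto simp: h_def add_nonneg_eq_0_iff)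
      then have "support (h (t, x)) = ?S" by blast
      then show ?thesis using L(3)[OF x'(2)] by simp
    qed
    have "(\<Sum>w\<in>support (h (t, x)). h (t, x) w) = (\<Sum>w\<in>?S. h (t, x) w)"
      using fin by (intro sum.mono_neutral_left) (auto simp: h_def split: if_splits)
    also have "\<dots> = (1 - t) * (\<Sum>w\<in>?S. x w) + t * (\<Sum>w\<in>?S. if w = v then 1 else 0)"
      by (simp add: h_def sum.distrib sum_distrib_left)
    also have "(\<Sum>w\<in>?S. x w) = (\<Sum>w\<in>support x. x w)"
      using fin by (intro sum.mono_neutral_right) auto
    also have "(\<Sum>w\<in>?S. if w = v then 1 else 0) = (1::real)"
      using fin by simp
    finally have "(\<Sum>w\<in>support (h (t, x)). h (t, x) w) = 1" using x'(3) by simp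
    then show ?thesis using nn supp by (simp add: topspace_underlying_space)
  qed
  have "continuous_map (prod_topology (top_of_set {0..1}) ?X) (powertop_real UNIV) h"
  proof -
    have "continuous_map (prod_topology (top_of_set {0..1}) ?X) euclideanreal (\<lambda>z. h z w)" for w
    proof -
      have "continuous_map ?X euclideanreal (\<lambda>x. x w)"
        unfolding underlying_space_def by (intro continuous_intros) simp
      from continuous_map_compose[OF continuous_map_snd this]
      have 1: "continuous_map (prod_topology (top_of_set {0..1::real}) ?X) euclideanreal (\<lambda>z. snd z w)"
        by (simp add: comp_def)
      have "continuous_map (top_of_set {0..1::real}) euclideanreal (\<lambda>x. x)"
        by simp
      from continuous_map_compose[OF continuous_map_fst this]
      have 2: "continuous_map (prod_topology (top_of_set {0..1::real}) ?X) euclideanreal fst"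
        by (simp add: comp_def)
      show ?thesis unfolding h_def by (intro continuous_intros 1 2) simp_all
    qed
    then show ?thesis by (simp add: continuous_map_componentwise_UNIV)
  qed
  then have cont: "continuous_map (prod_topology (top_of_set {0..1}) ?X) ?X h"
    using mem unfolding underlying_space_def
    by (auto simp: continuous_map_in_subtopology topspace_underlying_space)
  have "homotopic_with (\<lambda>x. True) ?X ?X id (\<lambda>x w. if w = v then 1 else 0)"
    unfolding homotopic_with_def using cont by (intro exI[of _ h]) (simp add: h_def id_def)
  then show ?thesis unfolding contractible_space_def by blast
qed

section \<open>Chain maps between simplicial and small singular chains\<close>

text \<open>
The complex of all finite simplices on the vertex type. The chain maps are constructed here once and
restrict to all subcomplexes.
\<close>

abbreviation full_complex :: "'v set set" where
  "full_complex \<equiv> {\<sigma>. finite \<sigma> \<and> \<sigma> \<noteq> {}}"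

abbreviation corner :: "nat \<Rightarrow> nat \<Rightarrow> real" where
  "corner i \<equiv> (\<lambda>j. if j = i then 1 else 0)"

lemma face_closed_full: "face_closed full_complex"
  by (auto simp: face_closed_def finite_subset)

lemma face_closed_faces: "face_closed (faces \<sigma>)"
  by (auto simp: face_closed_def)

text \<open>
The carrier of the comparison map from simplicial to singular chains: a simplex is carried by its
closed geometric simplex.
\<close>

interpretation geometric: carried_complexes
  "simplices (full_complex :: 'v::linorder set set)" simplex_boundary
  "\<lambda>p. singular_simplex_set p (underlying_space (full_complex :: 'v set set))" chain_boundary
  "\<lambda>_ \<sigma> q. singular_simplex_set q (underlying_space (faces \<sigma>))"
proof -
  interpret S: based_complex "simplices (full_complex :: 'v set set)" simplex_boundary
    by (rule simplicial_based_complex[OF face_closed_full])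
  interpret T: based_complex "\<lambda>p. singular_simplex_set p (underlying_space (full_complex :: 'v set set))"
    chain_boundary by (rule singular_based_complex)
  show "carried_complexes (simplices (full_complex :: 'v set set)) simplex_boundary
    (\<lambda>p. singular_simplex_set p (underlying_space (full_complex :: 'v set set))) chain_boundary
    (\<lambda>_ \<sigma> q. singular_simplex_set q (underlying_space (faces \<sigma>)))"
  proof
    fix x :: "'v set" and p
    assume x: "x \<in> simplices full_complex p"
    then obtain v where "v \<in> x" by auto
    then have "contractible_space (underlying_space (faces x))"
      using x by (intro contractible_underlying_space_cone[of _ v] face_closed_faces)
        (auto dest: finite_subset)
    then show "acyclic_bases chain_boundary (\<lambda>q. singular_simplex_set q (underlying_space (faces x)))"
      by (rule contractible_space_acyclic)
  next
    fix x y :: "'v set" and p q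
    assume "x \<in> simplices full_complex (Suc p)"
      and "y \<in> Poly_Mapping.keys (simplex_boundary (Suc p) (frag_of x))"
    then have "y \<subseteq> x" using keys_simplex_boundary by auto
    then show "singular_simplex_set q (underlying_space (faces y))
        \<subseteq> singular_simplex_set q (underlying_space (faces x))"
      by (auto elim!: singular_simplex_underlying_space_mono)
  qed
qed

text \<open>
The singular \<open>0\<close>-simplex at the vertex \<open>v\<close>, for \<open>\<sigma> = {v}\<close>.
\<close>

definition vertex_point :: "'v set \<Rightarrow> (nat \<Rightarrow> real) \<Rightarrow> 'v \<Rightarrow> real" where
  "vertex_point \<sigma> = (\<lambda>t\<in>standard_simplex 0. \<lambda>w. if w \<in> \<sigma> then 1 else 0)"

lemma geometric_chain_map_exists:
  "\<exists>j. j 0 = (\<lambda>\<sigma> :: 'v::linorder set. frag_of (vertex_point \<sigma>)) \<and> geometric.carried_chain_map j"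
proof (rule geometric.carried_chain_map_exists)
  fix x :: "'v set"
  assume "x \<in> simplices full_complex 0"
  then obtain v where x: "x = {v}" by (auto simp: card_Suc_eq)
  have "singular_simplex 0 (underlying_space (faces x)) (vertex_point x)"
    unfolding singular_simplex_underlying_space
    by (auto simp: vertex_point_def singular_simplex_def x topspace_underlying_space
        intro!: continuous_map_eq[of _ _ "\<lambda>t w. if w = v then 1 else 0"])
  then show "Poly_Mapping.keys (frag_of (vertex_point x)) \<subseteq>
      singular_simplex_set 0 (underlying_space (faces x))" by simp
qed simp

text \<open>
A vertex at which the barycentric coordinate is largest; any choice among ties will do.
\<close>

definition dominant_vertex :: "('v \<Rightarrow> real) \<Rightarrow> 'v" where
  "dominant_vertex x = (SOME v. \<forall>w. x w \<le> x v)"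

lemma dominant_vertex:
  assumes "x \<in> topspace (underlying_space full_complex)"
  shows "x w \<le> x (dominant_vertex x)" and "0 < x (dominant_vertex x)"
proof -
  have x: "\<And>w. 0 \<le> x w" "finite (support x)" "support x \<noteq> {}"
    using assms by (auto simp: topspace_underlying_space)
  let ?M = "Max (x ` support x)"
  have "?M \<in> x ` support x" using x by (intro Max_in) auto
  then obtain v where v: "x v \<noteq> 0" "x v = ?M" by auto
  have max: "x w \<le> x v" for w
    using x(1)[of v] v x(2) by (cases "x w = 0") auto
  then have "\<forall>w. x w \<le> x v" by blast
  then have *: "\<forall>w. x w \<le> x (dominant_vertex x)" unfolding dominant_vertex_def by (rule someI)
  then show "x w \<le> x (dominant_vertex x)" by blast
  have "0 < x v" using v x(1)[of v] by simp
  then show "0 < x (dominant_vertex x)" using * less_le_trans by blast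
qed

text \<open>
Smallness makes the dominant vertices of the corners span a simplex of every complex whose polyhedron
contains the image: they lie in the support of each point of the image.
\<close>

definition small_simplex :: "nat \<Rightarrow> ((nat \<Rightarrow> real) \<Rightarrow> 'v \<Rightarrow> real) \<Rightarrow> bool" where
  "small_simplex p f \<longleftrightarrow> singular_simplex p (underlying_space full_complex) f \<and>
     (\<forall>i\<le>p. \<forall>x\<in>standard_simplex p. f x (dominant_vertex (f (corner i))) \<noteq> 0)"

abbreviation small_simplices :: "nat \<Rightarrow> ((nat \<Rightarrow> real) \<Rightarrow> 'v \<Rightarrow> real) set" where
  "small_simplices p \<equiv> Collect (small_simplex p)"

definition corner_vertices :: "nat \<Rightarrow> ((nat \<Rightarrow> real) \<Rightarrow> 'v \<Rightarrow> real) \<Rightarrow> 'v set" where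
  "corner_vertices p f = (\<lambda>i. dominant_vertex (f (corner i))) ` {..p}"

lemma keys_chain_boundary_of:
  assumes "g \<in> Poly_Mapping.keys (chain_boundary (Suc p) (frag_of f))"
  shows "\<exists>k\<le>Suc p. g = singular_face (Suc p) k f"
  using assms keys_sum[of "\<lambda>k. frag_cmul ((-1) ^ k) (frag_of (singular_face (Suc p) k f))" "{..Suc p}"]
  by (force simp: chain_boundary_of simp del: sum.atMost_Suc)

lemma singular_face_corner:
  assumes "i \<le> p"
  shows "singular_face (Suc p) k f (corner i) = f (corner (if i < k then i else Suc i))"
proof -
  have "simplical_face k (corner i) = corner (if i < k then i else Suc i)"
    by (rule ext) (auto simp: simplical_face_def)
  then show ?thesis using assms by (simp add: singular_face_def)
qed

lemma singular_face_image:
  assumes "k \<le> Suc p" "x \<in> standard_simplex p"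
  shows "\<exists>y\<in>standard_simplex (Suc p). singular_face (Suc p) k f x = f y"
  using assms simplical_face_in_standard_simplex[of "Suc p" k x]
  by (intro bexI[of _ "simplical_face k x"]) (auto simp: singular_face_def)

lemma corner_vertices_face:
  assumes "k \<le> Suc p"
  shows "corner_vertices p (singular_face (Suc p) k f) \<subseteq> corner_vertices (Suc p) f"
  using assms by (auto simp: corner_vertices_def singular_face_corner)

lemma corner_vertices_support:
  assumes "small_simplex p f" "x \<in> standard_simplex p"
  shows "corner_vertices p f \<subseteq> support (f x)"
  using assms by (auto simp: small_simplex_def corner_vertices_def)

lemma corner_vertices_finite: "finite (corner_vertices p f)" "corner_vertices p f \<noteq> {}"
  by (auto simp: corner_vertices_def)

lemma small_simplex_face:
  assumes f: "small_simplex (Suc p) f" and k: "k \<le> Suc p"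
  shows "small_simplex p (singular_face (Suc p) k f)"
  unfolding small_simplex_def
proof (intro conjI allI impI ballI)
  show "singular_simplex p (underlying_space full_complex) (singular_face (Suc p) k f)"
    using singular_simplex_singular_face[of "Suc p" _ f k] f k by (simp add: small_simplex_def)
  fix i x assume i: "i \<le> p" and x: "x \<in> standard_simplex p"
  show "singular_face (Suc p) k f x (dominant_vertex (singular_face (Suc p) k f (corner i))) \<noteq> 0"
    using f singular_face_image[OF k x, of f] i
    by (auto simp: singular_face_corner small_simplex_def)
qed

lemma small_based_complex: "based_complex small_simplices chain_boundary"
proof -
  interpret T: based_complex "\<lambda>p. singular_simplex_set p (underlying_space (full_complex :: 'v set set))"
    chain_boundary by (rule singular_based_complex)
  have sing: "singular_simplex p (underlying_space full_complex) f" if "small_simplex p f"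
    for p and f :: "(nat \<Rightarrow> real) \<Rightarrow> 'v \<Rightarrow> real"
    using that by (simp add: small_simplex_def)
  show "based_complex (small_simplices :: nat \<Rightarrow> ((nat \<Rightarrow> real) \<Rightarrow> 'v \<Rightarrow> real) set) chain_boundary"
  proof
    show "Poly_Mapping.keys (chain_boundary (Suc p) (frag_of f)) \<subseteq> small_simplices p"
      if "f \<in> small_simplices (Suc p)" for p and f :: "(nat \<Rightarrow> real) \<Rightarrow> 'v \<Rightarrow> real"
      using that by (auto dest!: keys_chain_boundary_of intro: small_simplex_face)
    show "chain_boundary (Suc p) (chain_boundary (Suc (Suc p)) (frag_of f)) = 0"
      if "f \<in> small_simplices (Suc (Suc p))" for p and f :: "(nat \<Rightarrow> real) \<Rightarrow> 'v \<Rightarrow> real"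
      using that sing by (intro T.bd_bd) simp
    show "augmentation (chain_boundary (Suc 0) (frag_of f)) = 0"
      if "f \<in> small_simplices (Suc 0)" for f :: "(nat \<Rightarrow> real) \<Rightarrow> 'v \<Rightarrow> real"
      using that sing by (intro T.aug_bd) simp
  qed (simp_all add: T.bd_diff T.bd_0)
qed

text \<open>
The carrier of the map back from small singular chains to simplicial chains: the closed simplex on the
corner vertices. A face has some of the corners of the simplex, so the carrier is monotone.
\<close>

interpretation vertex: carried_complexes
  "small_simplices :: nat \<Rightarrow> ((nat \<Rightarrow> real) \<Rightarrow> 'v::linorder \<Rightarrow> real) set" chain_boundary
  "simplices (full_complex :: 'v set set)" simplex_boundary
  "\<lambda>p f. simplices (faces (corner_vertices p f))"
proof -
  interpret S: based_complex "small_simplices :: nat \<Rightarrow> ((nat \<Rightarrow> real) \<Rightarrow> 'v \<Rightarrow> real) set" chain_boundary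
    by (rule small_based_complex)
  show "carried_complexes (small_simplices :: nat \<Rightarrow> ((nat \<Rightarrow> real) \<Rightarrow> 'v \<Rightarrow> real) set) chain_boundary
    (simplices (full_complex :: 'v set set)) simplex_boundary
    (\<lambda>p f. simplices (faces (corner_vertices p f)))"
  proof
    fix x :: "(nat \<Rightarrow> real) \<Rightarrow> 'v \<Rightarrow> real" and p
    show "acyclic_bases simplex_boundary (simplices (faces (corner_vertices p x)))"
      by (rule acyclic_simplex) (rule corner_vertices_finite)+
  next
    fix x y :: "(nat \<Rightarrow> real) \<Rightarrow> 'v \<Rightarrow> real" and p q
    assume "y \<in> Poly_Mapping.keys (chain_boundary (Suc p) (frag_of x))"
    then have "corner_vertices p y \<subseteq> corner_vertices (Suc p) x"
      by (auto dest!: keys_chain_boundary_of corner_vertices_face)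
    then show "simplices (faces (corner_vertices p y)) q \<subseteq> simplices (faces (corner_vertices (Suc p) x)) q"
      by auto
  qed
qed

lemma vertex_chain_map_exists:
  "\<exists>\<psi>. \<psi> 0 = (\<lambda>f :: (nat \<Rightarrow> real) \<Rightarrow> 'v::linorder \<Rightarrow> real. frag_of (corner_vertices 0 f))
     \<and> vertex.carried_chain_map \<psi>"
  by (rule vertex.carried_chain_map_exists) (auto simp: corner_vertices_def)

text \<open>
The supports of the points in the image of \<open>f\<close>, together with their faces. If \<open>f\<close> is small, the
polyhedron of this complex contains the image of \<open>f\<close> and the simplex on the corner vertices, and it is a
cone with each corner vertex as apex.
\<close>

definition supports_complex :: "nat \<Rightarrow> ((nat \<Rightarrow> real) \<Rightarrow> 'v \<Rightarrow> real) \<Rightarrow> 'v set set" where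
  "supports_complex p f = {\<tau>. \<tau> \<noteq> {} \<and> (\<exists>x\<in>standard_simplex p. \<tau> \<subseteq> support (f x))}"

text \<open>
The carrier of the homotopy on small singular chains. It is contractible because all supports contain
the dominant vertex of the first corner.
\<close>

interpretation support: carried_complexes
  "small_simplices :: nat \<Rightarrow> ((nat \<Rightarrow> real) \<Rightarrow> 'v::linorder \<Rightarrow> real) set" chain_boundary
  "\<lambda>p. singular_simplex_set p (underlying_space (full_complex :: 'v set set))" chain_boundary
  "\<lambda>p f q. singular_simplex_set q (underlying_space (supports_complex p f))"
proof -
  interpret S: based_complex "small_simplices :: nat \<Rightarrow> ((nat \<Rightarrow> real) \<Rightarrow> 'v \<Rightarrow> real) set" chain_boundary
    by (rule small_based_complex)
  show "carried_complexes (small_simplices :: nat \<Rightarrow> ((nat \<Rightarrow> real) \<Rightarrow> 'v \<Rightarrow> real) set) chain_boundary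
    (\<lambda>p. singular_simplex_set p (underlying_space (full_complex :: 'v set set))) chain_boundary
    (\<lambda>p f q. singular_simplex_set q (underlying_space (supports_complex p f)))"
  proof
    fix f :: "(nat \<Rightarrow> real) \<Rightarrow> 'v \<Rightarrow> real" and p
    assume "f \<in> small_simplices p"
    then have f: "small_simplex p f" by simp
    have "contractible_space (underlying_space (supports_complex p f))"
    proof (rule contractible_underlying_space_cone[of _ "dominant_vertex (f (corner 0))"])
      show "face_closed (supports_complex p f)"
        unfolding face_closed_def supports_complex_def by blast
      fix \<tau> assume "\<tau> \<in> supports_complex p f"
      then obtain x where x: "x \<in> standard_simplex p" "\<tau> \<subseteq> support (f x)"
        by (auto simp: supports_complex_def)
      have "f x \<in> topspace (underlying_space full_complex)"
        using f x(1) by (auto simp: small_simplex_def singular_simplex_underlying_space)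
      then have "finite (support (f x))" by (simp add: topspace_underlying_space)
      then show "finite \<tau>" using x(2) finite_subset by blast
      have "dominant_vertex (f (corner 0)) \<in> support (f x)"
        using f x(1) by (auto simp: small_simplex_def)
      then show "insert (dominant_vertex (f (corner 0))) \<tau> \<in> supports_complex p f"
        using x by (auto simp: supports_complex_def)
    qed
    then show "acyclic_bases chain_boundary
        (\<lambda>q. singular_simplex_set q (underlying_space (supports_complex p f)))"
      by (rule contractible_space_acyclic)
  next
    fix x y :: "(nat \<Rightarrow> real) \<Rightarrow> 'v \<Rightarrow> real" and p q
    assume "y \<in> Poly_Mapping.keys (chain_boundary (Suc p) (frag_of x))"
    then obtain k where k: "k \<le> Suc p" "y = singular_face (Suc p) k x"
      by (auto dest!: keys_chain_boundary_of)
    have "supports_complex p y \<subseteq> supports_complex (Suc p) x"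
    proof
      fix \<tau> assume "\<tau> \<in> supports_complex p y"
      then obtain z where z: "\<tau> \<noteq> {}" "z \<in> standard_simplex p" "\<tau> \<subseteq> support (y z)"
        by (auto simp: supports_complex_def)
      obtain z' where "z' \<in> standard_simplex (Suc p)" "y z = x z'"
        using singular_face_image[OF k(1) z(2), of x] k(2) by metis
      then show "\<tau> \<in> supports_complex (Suc p) x"
        using z by (auto simp: supports_complex_def)
    qed
    then show "singular_simplex_set q (underlying_space (supports_complex p y)) \<subseteq>
        singular_simplex_set q (underlying_space (supports_complex (Suc p) x))"
      by (auto elim: singular_simplex_underlying_space_mono)
  qed
qed

lemma small_simplex_supports_complex:
  assumes f: "small_simplex p f"
  shows "singular_simplex p (underlying_space (supports_complex p f)) f"
proof -
  have "f x \<in> topspace (underlying_space (supports_complex p f))" if "x \<in> standard_simplex p" for x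
    using f that
    by (auto simp: small_simplex_def singular_simplex_underlying_space topspace_underlying_space
        supports_complex_def)
  then show ?thesis using f by (auto simp: small_simplex_def singular_simplex_underlying_space)
qed

text \<open>
Passing from a small singular simplex to its corner vertices and back is homotopic to the identity, as
both are carried by \<^const>\<open>supports_complex\<close>.
\<close>

lemma geometric_vertex_homotopy:
  assumes j: "geometric.carried_chain_map j" and \<psi>: "vertex.carried_chain_map \<psi>"
  shows "\<exists>h. \<forall>p. \<forall>f\<in>small_simplices p.
     Poly_Mapping.keys (h p f) \<subseteq> singular_simplex_set (Suc p) (underlying_space (supports_complex p f)) \<and>
     chain_boundary (Suc p) (h p f) =
       frag_extend (j p) (\<psi> p f) - frag_of f - frag_extend (h (p - 1)) (chain_boundary p (frag_of f))"
proof (rule support.carried_homotopy_exists[where f = "\<lambda>p f. frag_extend (j p) (\<psi> p f)" and g = "\<lambda>p. frag_of"])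
  have \<psi>': "Poly_Mapping.keys (\<psi> p f) \<subseteq> simplices (faces (corner_vertices p f)) p"
    "simplex_boundary p (\<psi> p f) = frag_extend (\<psi> (p - 1)) (chain_boundary p (frag_of f))"
    "p = 0 \<Longrightarrow> augmentation (\<psi> p f) = frag_of ()" if "small_simplex p f" for p f
    using \<psi> that unfolding vertex.carried_chain_map_def by blast+
  have full: "simplices (faces (corner_vertices p f)) p \<subseteq> simplices full_complex p" for p and f :: "(nat \<Rightarrow> real) \<Rightarrow> 'a \<Rightarrow> real"
    using corner_vertices_finite(1)[of p f] finite_subset by auto
  show "support.carried_chain_map (\<lambda>p f. frag_extend (j p) (\<psi> p f))"
    unfolding support.carried_chain_map_def
  proof (intro allI ballI conjI impI)
    fix p and f :: "(nat \<Rightarrow> real) \<Rightarrow> 'a \<Rightarrow> real" assume "f \<in> small_simplices p"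
    then have f: "small_simplex p f" by simp
    have keys: "Poly_Mapping.keys (\<psi> p f) \<subseteq> simplices full_complex p"
      using \<psi>'(1)[OF f] full by blast
    show "Poly_Mapping.keys (frag_extend (j p) (\<psi> p f))
        \<subseteq> singular_simplex_set p (underlying_space (supports_complex p f))"
    proof (rule keys_frag_extend_subset)
      fix \<sigma> assume \<sigma>: "\<sigma> \<in> Poly_Mapping.keys (\<psi> p f)"
      then have "Poly_Mapping.keys (j p \<sigma>) \<subseteq> singular_simplex_set p (underlying_space (faces \<sigma>))"
        using j keys unfolding geometric.carried_chain_map_def by blast
      moreover have "faces \<sigma> \<subseteq> supports_complex p f"
        using \<psi>'(1)[OF f] \<sigma> corner_vertices_support[OF f] nonempty_standard_simplex[of p]
        unfolding supports_complex_def by blast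
      ultimately show "Poly_Mapping.keys (j p \<sigma>)
          \<subseteq> singular_simplex_set p (underlying_space (supports_complex p f))"
        using singular_simplex_underlying_space_mono by blast
    qed
    show "chain_boundary p (frag_extend (j p) (\<psi> p f)) =
        frag_extend (\<lambda>f. frag_extend (j (p - 1)) (\<psi> (p - 1) f)) (chain_boundary p (frag_of f))"
      using geometric.carried_chain_map_chain[OF j keys] by (simp add: \<psi>'(2)[OF f] frag_extend_extend)
    show "augmentation (frag_extend (j p) (\<psi> p f)) = frag_of ()" if "p = 0"
      using geometric.carried_chain_map_augmentation[OF j] keys \<psi>'(3)[OF f] that by simp
  qed
  show "support.carried_chain_map (\<lambda>p. frag_of)"
    unfolding support.carried_chain_map_def
    by (auto simp: small_simplex_supports_complex simp flip: frag_expansion)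
qed

section \<open>Subdivision\<close>

lemma openin_Collect_ball:
  assumes "finite I" "\<And>i. i \<in> I \<Longrightarrow> openin X {x \<in> topspace X. P i x}"
  shows "openin X {x \<in> topspace X. \<forall>i\<in>I. P i x}"
  using assms
proof (induction I rule: finite_induct)
  case (insert i I)
  have "{x \<in> topspace X. \<forall>i\<in>insert i I. P i x} =
      {x \<in> topspace X. P i x} \<inter> {x \<in> topspace X. \<forall>i\<in>I. P i x}" by auto
  then show ?case using insert by auto
qed auto

lemma singular_chain_iterated_subdivision:
  "singular_chain p X c \<Longrightarrow> singular_chain p X ((singular_subdivision p ^^ m) c)"
  by (induction m) (auto intro: singular_chain_singular_subdivision)

lemma chain_boundary_iterated_subdivision:
  "singular_chain p X c \<Longrightarrow> chain_boundary p ((singular_subdivision p ^^ m) c) =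
     (singular_subdivision (p - 1) ^^ m) (chain_boundary p c)"
proof (induction m)
  case (Suc m)
  then show ?case
    using chain_boundary_singular_subdivision[OF singular_chain_iterated_subdivision[OF Suc.prems]]
    by simp
qed simp

lemma iterated_subdivision_zero:
  "singular_chain 0 X c \<Longrightarrow> (singular_subdivision 0 ^^ m) c = c"
  by (induction m) (auto simp: singular_subdivision_zero)

text \<open>
For a set \<open>M\<close> of vertices consider the open set of all points whose coordinates in \<open>M\<close> are positive and
exceed all the others. These sets cover the polyhedron: take for \<open>M\<close> the vertices at which the coordinate
of a given point is largest. The dominant vertex of a point of such a set lies in \<open>M\<close>, where all
points of the set have positive coordinates. So a singular simplex inside one of these sets is small.
\<close>

lemma subdivision_eventually_small:
  fixes A :: "'v set set"
  assumes A: "A \<subseteq> full_complex" "finite A" and c: "singular_chain p (underlying_space A) c"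
  shows "\<forall>\<^sub>F m in sequentially. Poly_Mapping.keys ((singular_subdivision p ^^ m) c) \<subseteq> small_simplices p"
proof -
  let ?X = "underlying_space A"
  define V where "V = \<Union>A"
  have finV: "finite V" using A by (auto simp: V_def)
  define U where "U M = {x \<in> topspace ?X. \<forall>w\<in>M. 0 < x w \<and> (\<forall>u\<in>V - M. x u < x w)}" for M
  define \<C> where "\<C> = U ` {M. M \<subseteq> V \<and> M \<noteq> {}}"
  have XF: "topspace ?X \<subseteq> topspace (underlying_space full_complex)"
    using A(1) by (auto simp: topspace_underlying_space)
  \<comment> \<open>Only vertices of \<open>A\<close> can be dominant, so finitely many coordinates matter.\<close>
  have dom_V: "dominant_vertex x \<in> V" if "x \<in> topspace ?X" for x
  proof -
    have "support x \<in> A" using that by (simp add: topspace_underlying_space)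
    moreover have "dominant_vertex x \<in> support x"
      using dominant_vertex(2)[OF subsetD[OF XF that]] by simp
    ultimately show ?thesis by (auto simp: V_def)
  qed
  have coord: "continuous_map ?X euclideanreal (\<lambda>x. x w)" for w
    unfolding underlying_space_def by (intro continuous_intros) simp
  have opens: "openin ?X T" if "T \<in> \<C>" for T
  proof -
    from that obtain M where M: "M \<subseteq> V" "T = U M" by (auto simp: \<C>_def)
    have finM: "finite M" "finite (V - M)" using M finV finite_subset by auto
    have 1: "openin ?X {x \<in> topspace ?X. 0 < x w}" for w
      using openin_continuous_map_preimage[OF coord, of "{0<..}" w] by simp
    have 2: "openin ?X {x \<in> topspace ?X. x u < x w}" for u w
    proof -
      have "continuous_map ?X euclideanreal (\<lambda>x. x w - x u)"
        by (intro continuous_intros coord)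
      then show ?thesis
        using openin_continuous_map_preimage[of ?X euclideanreal "\<lambda>x. x w - x u" "{0<..}"] by simp
    qed
    have "openin ?X {x \<in> topspace ?X. 0 < x w \<and> (\<forall>u\<in>V - M. x u < x w)}" for w
    proof -
      have "{x \<in> topspace ?X. 0 < x w \<and> (\<forall>u\<in>V - M. x u < x w)} =
        {x \<in> topspace ?X. 0 < x w} \<inter> {x \<in> topspace ?X. \<forall>u\<in>V - M. x u < x w}" by auto
      moreover have "openin ?X ({x \<in> topspace ?X. 0 < x w} \<inter> {x \<in> topspace ?X. \<forall>u\<in>V - M. x u < x w})"
        by (intro openin_Int 1 openin_Collect_ball finM 2)
      ultimately show ?thesis by (simp only:)
    qed
    then show ?thesis unfolding M(2) U_def by (intro openin_Collect_ball finM)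
  qed
  have cover: "topspace ?X \<subseteq> \<Union>\<C>"
  proof
    fix x assume x: "x \<in> topspace ?X"
    note dom = dominant_vertex[of x, OF subsetD[OF XF x]]
    let ?M = "{w \<in> V. x w = x (dominant_vertex x)}"
    have "x \<in> U ?M" using x dom by (auto simp: U_def less_le)
    moreover have "?M \<subseteq> V" "?M \<noteq> {}" using dom_V[OF x] by auto
    ultimately show "x \<in> \<Union>\<C>" unfolding \<C>_def by (intro UnionI[of "U ?M"] imageI CollectI conjI)
  qed
  obtain n where n: "\<And>m f. n \<le> m \<Longrightarrow> f \<in> Poly_Mapping.keys ((singular_subdivision p ^^ m) c) \<Longrightarrow>
      \<exists>T\<in>\<C>. f \<in> standard_simplex p \<rightarrow> T"
    using sufficient_iterated_singular_subdivision_exists[OF opens cover c] by metis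
  have "Poly_Mapping.keys ((singular_subdivision p ^^ m) c) \<subseteq> small_simplices p" if m: "n \<le> m" for m
  proof
    fix f assume f: "f \<in> Poly_Mapping.keys ((singular_subdivision p ^^ m) c)"
    then obtain M where M: "M \<subseteq> V" "M \<noteq> {}" "f \<in> standard_simplex p \<rightarrow> U M"
      using n[OF m] unfolding \<C>_def by blast
    have sing: "singular_simplex p ?X f"
      using f singular_chain_iterated_subdivision[OF c] by (auto simp: singular_chain_def)
    have "f x (dominant_vertex (f (corner i))) \<noteq> 0"
      if i: "i \<le> p" and x: "x \<in> standard_simplex p" for i x
    proof -
      let ?y = "f (corner i)"
      have y: "?y \<in> U M" using M(3) i by auto
      then have yX: "?y \<in> topspace ?X" by (simp add: U_def)
      have "dominant_vertex ?y \<in> M"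
      proof (rule ccontr)
        assume "dominant_vertex ?y \<notin> M"
        moreover obtain w where "w \<in> M" using M(2) by auto
        ultimately have "?y (dominant_vertex ?y) < ?y w"
          using y dom_V[OF yX] by (auto simp: U_def)
        then show False using dominant_vertex(1)[OF subsetD[OF XF yX], of w] by simp
      qed
      moreover have "f x \<in> U M" using M(3) x by auto
      ultimately show ?thesis by (auto simp: U_def)
    qed
    then show "f \<in> small_simplices p"
      using sing singular_simplex_underlying_space_mono[OF sing A(1)] by (simp add: small_simplex_def)
  qed
  then show ?thesis by (auto simp: eventually_sequentially)
qed

text \<open>
The other composite: a simplex, turned into a singular chain, subdivided until it is small and turned
back by corner vertices, never leaves its closed simplex, which is acyclic.
\<close>

lemma vertex_geometric_homotopy:
  fixes A :: "'v::linorder set set"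
  assumes j: "geometric.carried_chain_map j" and \<psi>: "vertex.carried_chain_map \<psi>"
    and A: "A \<subseteq> full_complex" "face_closed A"
    and small: "\<And>p \<sigma>. \<sigma> \<in> simplices A p \<Longrightarrow>
      Poly_Mapping.keys ((singular_subdivision p ^^ m) (j p \<sigma>)) \<subseteq> small_simplices p"
  shows "\<exists>h. \<forall>p. \<forall>\<sigma>\<in>simplices A p.
     Poly_Mapping.keys (h p \<sigma>) \<subseteq> simplices (faces \<sigma>) (Suc p) \<and>
     simplex_boundary (Suc p) (h p \<sigma>) =
       frag_extend (\<psi> p) ((singular_subdivision p ^^ m) (j p \<sigma>)) - frag_of \<sigma>
         - frag_extend (h (p - 1)) (simplex_boundary p (frag_of \<sigma>))"
proof -
  interpret S: based_complex "simplices A" simplex_boundary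
    by (rule simplicial_based_complex[OF A(2)])
  interpret T: based_complex "simplices (full_complex :: 'v set set)" simplex_boundary
    by (rule simplicial_based_complex[OF face_closed_full])
  interpret closure: carried_complexes "simplices A" simplex_boundary
    "simplices (full_complex :: 'v set set)" simplex_boundary "\<lambda>p \<sigma>. simplices (faces \<sigma>)"
  proof
    fix x :: "'v set" and p
    assume "x \<in> simplices A p"
    then have "finite x" "x \<noteq> {}" using A(1) by auto
    then show "acyclic_bases simplex_boundary (simplices (faces x))" by (rule acyclic_simplex)
  next
    fix x y :: "'v set" and p q
    assume "x \<in> simplices A (Suc p)"
      and "y \<in> Poly_Mapping.keys (simplex_boundary (Suc p) (frag_of x))"
    then have "y \<subseteq> x" using keys_simplex_boundary by auto
    then show "simplices (faces y) q \<subseteq> simplices (faces x) q" by auto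
  qed
  have j': "singular_chain p (underlying_space (faces \<sigma>)) (j p \<sigma>)"
    "chain_boundary p (j p \<sigma>) = frag_extend (j (p - 1)) (simplex_boundary p (frag_of \<sigma>))"
    "p = 0 \<Longrightarrow> augmentation (j p \<sigma>) = frag_of ()" if "\<sigma> \<in> simplices A p" for p \<sigma>
  proof -
    have "\<sigma> \<in> simplices full_complex p" using that A(1) by auto
    then show "singular_chain p (underlying_space (faces \<sigma>)) (j p \<sigma>)"
      "chain_boundary p (j p \<sigma>) = frag_extend (j (p - 1)) (simplex_boundary p (frag_of \<sigma>))"
      "p = 0 \<Longrightarrow> augmentation (j p \<sigma>) = frag_of ()"
      using j unfolding geometric.carried_chain_map_def singular_chain_def by blast+
  qed
  show ?thesis
  proof (rule closure.carried_homotopy_exists[where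
        f = "\<lambda>p \<sigma>. frag_extend (\<psi> p) ((singular_subdivision p ^^ m) (j p \<sigma>))" and g = "\<lambda>p. frag_of"])
    show "closure.carried_chain_map (\<lambda>p. frag_of)"
      unfolding closure.carried_chain_map_def using A(1) by (auto simp flip: frag_expansion)
    show "closure.carried_chain_map (\<lambda>p \<sigma>. frag_extend (\<psi> p) ((singular_subdivision p ^^ m) (j p \<sigma>)))"
      unfolding closure.carried_chain_map_def
    proof (intro allI ballI conjI impI)
      fix p \<sigma> assume \<sigma>: "\<sigma> \<in> simplices A p"
      let ?c = "(singular_subdivision p ^^ m) (j p \<sigma>)"
      show "Poly_Mapping.keys (frag_extend (\<psi> p) ?c) \<subseteq> simplices (faces \<sigma>) p"
      proof (rule keys_frag_extend_subset)
        fix f assume f: "f \<in> Poly_Mapping.keys ?c"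
        then have sm: "small_simplex p f" using small[OF \<sigma>] by auto
        have "singular_simplex p (underlying_space (faces \<sigma>)) f"
          using singular_chain_iterated_subdivision[OF j'(1)[OF \<sigma>]] f by (auto simp: singular_chain_def)
        moreover obtain x where x: "x \<in> standard_simplex p"
          using nonempty_standard_simplex by blast
        ultimately have "support (f x) \<subseteq> \<sigma>"
          by (auto simp: singular_simplex_underlying_space topspace_underlying_space)
        then have "corner_vertices p f \<subseteq> \<sigma>" using corner_vertices_support[OF sm x] by blast
        moreover have "Poly_Mapping.keys (\<psi> p f) \<subseteq> simplices (faces (corner_vertices p f)) p"
          using \<psi> sm unfolding vertex.carried_chain_map_def by blast
        ultimately show "Poly_Mapping.keys (\<psi> p f) \<subseteq> simplices (faces \<sigma>) p" by blast
      qed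
      have "simplex_boundary p (frag_extend (\<psi> p) ?c) = frag_extend (\<psi> (p - 1)) (chain_boundary p ?c)"
        by (rule vertex.carried_chain_map_chain[OF \<psi> small[OF \<sigma>]])
      also have "chain_boundary p ?c =
          (singular_subdivision (p - 1) ^^ m) (frag_extend (j (p - 1)) (simplex_boundary p (frag_of \<sigma>)))"
        by (simp add: chain_boundary_iterated_subdivision[OF j'(1)[OF \<sigma>]] j'(2)[OF \<sigma>])
      also have "\<dots> = frag_extend (\<lambda>\<tau>. (singular_subdivision (p - 1) ^^ m) (j (p - 1) \<tau>))
          (simplex_boundary p (frag_of \<sigma>))"
        by (rule additive_frag_extend) (rule singular_subdivision_power_diff)
      finally show "simplex_boundary p (frag_extend (\<psi> p) ?c) =
          frag_extend (\<lambda>\<tau>. frag_extend (\<psi> (p - 1)) ((singular_subdivision (p - 1) ^^ m) (j (p - 1) \<tau>)))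
            (simplex_boundary p (frag_of \<sigma>))"
        by (simp add: frag_extend_extend)
      show "augmentation (frag_extend (\<psi> p) ?c) = frag_of ()" if p: "p = 0"
        using vertex.carried_chain_map_augmentation[OF \<psi>, of ?c] small[OF \<sigma>] p j'(3)[OF \<sigma>]
          iterated_subdivision_zero[of "underlying_space (faces \<sigma>)" "j 0 \<sigma>" m] j'(1)[OF \<sigma>]
        by simp
    qed
  qed
qed

section \<open>Change of coefficients from the integers to a field\<close>

lemma lookup_map_mult [simp]:
  "Poly_Mapping.lookup (Poly_Mapping.map ((*) (r :: 'k::field)) c) x = r * Poly_Mapping.lookup c x"
  by (simp add: Poly_Mapping.map.rep_eq when_def)

lemma lookup_map_of_int [simp]:
  "Poly_Mapping.lookup (Poly_Mapping.map (of_int :: int \<Rightarrow> 'k::field) c) x = of_int (Poly_Mapping.lookup c x)"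
  by (simp add: Poly_Mapping.map.rep_eq when_def)

lemma lookup_linear_extension:
  assumes "finite S" "Poly_Mapping.keys c \<subseteq> S"
  shows "Poly_Mapping.lookup (linear_extension g c) y =
    (\<Sum>x\<in>S. Poly_Mapping.lookup c x * Poly_Mapping.lookup (g x) y)"
proof -
  have "Poly_Mapping.lookup (linear_extension g c) y =
      (\<Sum>x\<in>Poly_Mapping.keys c. Poly_Mapping.lookup c x * Poly_Mapping.lookup (g x) y)"
    by (simp add: linear_extension_def lookup_sum)
  also have "\<dots> = (\<Sum>x\<in>S. Poly_Mapping.lookup c x * Poly_Mapping.lookup (g x) y)"
    using assms by (intro sum.mono_neutral_left) (auto simp: in_keys_iff)
  finally show ?thesis .
qed

lemma lookup_frag_extend:
  assumes "finite S" "Poly_Mapping.keys c \<subseteq> S"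
  shows "Poly_Mapping.lookup (frag_extend g c) y =
    (\<Sum>x\<in>S. Poly_Mapping.lookup c x * Poly_Mapping.lookup (g x) y)"
proof -
  have "Poly_Mapping.lookup (frag_extend g c) y =
      (\<Sum>x\<in>Poly_Mapping.keys c. Poly_Mapping.lookup c x * Poly_Mapping.lookup (g x) y)"
    by (simp add: frag_extend_def lookup_sum)
  also have "\<dots> = (\<Sum>x\<in>S. Poly_Mapping.lookup c x * Poly_Mapping.lookup (g x) y)"
    using assms by (intro sum.mono_neutral_left) (auto simp: in_keys_iff)
  finally show ?thesis .
qed

text \<open>
The extension of a map of integral chains to coefficients in the field. It is functorial, so that
identities between integral chain maps on basis elements carry over to the field.
\<close>

definition base_change :: "('b \<Rightarrow> ('c \<Rightarrow>\<^sub>0 int)) \<Rightarrow> ('b \<Rightarrow>\<^sub>0 'k) \<Rightarrow> ('c \<Rightarrow>\<^sub>0 'k::field)" where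
  "base_change g = linear_extension (\<lambda>x. Poly_Mapping.map of_int (g x))"

lemma lookup_base_change:
  assumes "finite S" "Poly_Mapping.keys c \<subseteq> S"
  shows "Poly_Mapping.lookup (base_change g c) y =
    (\<Sum>x\<in>S. Poly_Mapping.lookup c x * of_int (Poly_Mapping.lookup (g x) y))"
  using assms by (simp add: base_change_def lookup_linear_extension)

lemma keys_base_change:
  "Poly_Mapping.keys (base_change g c) \<subseteq> (\<Union>x\<in>Poly_Mapping.keys c. Poly_Mapping.keys (g x))"
proof
  fix y assume "y \<in> Poly_Mapping.keys (base_change g c)"
  then have "(\<Sum>x\<in>Poly_Mapping.keys c. Poly_Mapping.lookup c x * of_int (Poly_Mapping.lookup (g x) y)) \<noteq> 0"
    by (simp add: in_keys_iff lookup_base_change[of "Poly_Mapping.keys c"])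
  then obtain x where "x \<in> Poly_Mapping.keys c"
    "Poly_Mapping.lookup c x * of_int (Poly_Mapping.lookup (g x) y) \<noteq> 0"
    by (meson sum.not_neutral_contains_not_neutral)
  then show "y \<in> (\<Union>x\<in>Poly_Mapping.keys c. Poly_Mapping.keys (g x))"
    by (metis UN_I in_keys_iff mult_zero_right of_int_0)
qed

lemma keys_base_change_subset:
  assumes "\<And>x. x \<in> Poly_Mapping.keys c \<Longrightarrow> Poly_Mapping.keys (g x) \<subseteq> T"
  shows "Poly_Mapping.keys (base_change g c) \<subseteq> T"
  using keys_base_change[of g c] assms by blast

lemma base_change_add: "base_change g (c + d) = base_change g c + base_change g d"
proof (rule poly_mapping_eqI)
  fix y
  let ?S = "Poly_Mapping.keys c \<union> Poly_Mapping.keys d"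
  have "Poly_Mapping.keys (c + d) \<subseteq> ?S" by (rule keys_add)
  then show "Poly_Mapping.lookup (base_change g (c + d)) y =
      Poly_Mapping.lookup (base_change g c + base_change g d) y"
    by (simp add: lookup_add lookup_base_change[of ?S] sum.distrib algebra_simps)
qed

lemma base_change_smult:
  "base_change g (Poly_Mapping.map ((*) r) c) = Poly_Mapping.map ((*) r) (base_change g c)"
proof (rule poly_mapping_eqI)
  fix y
  have "Poly_Mapping.keys (Poly_Mapping.map ((*) r) c) \<subseteq> Poly_Mapping.keys c"
    by (auto simp: in_keys_iff)
  then show "Poly_Mapping.lookup (base_change g (Poly_Mapping.map ((*) r) c)) y =
      Poly_Mapping.lookup (Poly_Mapping.map ((*) r) (base_change g c)) y"
    by (simp add: lookup_base_change[of "Poly_Mapping.keys c"] sum_distrib_left mult.assoc)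
qed

lemma base_change_0 [simp]: "base_change g 0 = 0"
  by (simp add: base_change_def linear_extension_def)

lemma base_change_diff:
  fixes c d :: "'b \<Rightarrow>\<^sub>0 'k::field"
  shows "base_change g (c - d) = base_change g c - base_change g d"
  using base_change_add[of g "c - d" d] by (simp add: algebra_simps)

lemma base_change_cong:
  assumes "\<And>x. x \<in> Poly_Mapping.keys c \<Longrightarrow> f x = g x"
  shows "base_change f c = base_change g c"
  using assms by (simp add: base_change_def linear_extension_def)

lemma base_change_diff_fun:
  "base_change (\<lambda>x. f x - g x) c = base_change f c - base_change g c"
  by (rule poly_mapping_eqI)
    (simp add: lookup_base_change[of "Poly_Mapping.keys c"] lookup_minus sum_subtractf algebra_simps)

lemma base_change_of [simp]: "base_change frag_of c = c"
proof (rule poly_mapping_eqI)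
  fix y
  have "Poly_Mapping.lookup (base_change frag_of c) y =
      (\<Sum>x\<in>Poly_Mapping.keys c. if x = y then Poly_Mapping.lookup c x else 0)"
    unfolding lookup_base_change[OF finite_keys order_refl] by (intro sum.cong) auto
  also have "\<dots> = Poly_Mapping.lookup c y" by (simp add: in_keys_iff)
  finally show "Poly_Mapping.lookup (base_change frag_of c) y = Poly_Mapping.lookup c y" .
qed

text \<open>
Functoriality: both sides are the product of the same matrices.
\<close>

lemma base_change_base_change:
  "base_change g (base_change f c) = base_change (\<lambda>x. frag_extend g (f x)) c"
proof (rule poly_mapping_eqI)
  fix z
  let ?Y = "\<Union>x\<in>Poly_Mapping.keys c. Poly_Mapping.keys (f x)"
  have "Poly_Mapping.lookup (base_change g (base_change f c)) z =
      (\<Sum>y\<in>?Y. (\<Sum>x\<in>Poly_Mapping.keys c. Poly_Mapping.lookup c x * of_int (Poly_Mapping.lookup (f x) y))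
         * of_int (Poly_Mapping.lookup (g y) z))"
    using lookup_base_change[of ?Y "base_change f c" g z] keys_base_change[of f c]
    by (simp add: lookup_base_change[of "Poly_Mapping.keys c" c f])
  also have "\<dots> = (\<Sum>x\<in>Poly_Mapping.keys c. \<Sum>y\<in>?Y. Poly_Mapping.lookup c x *
      of_int (Poly_Mapping.lookup (f x) y) * of_int (Poly_Mapping.lookup (g y) z))"
    by (subst sum.swap) (simp add: sum_distrib_right)
  also have "\<dots> = (\<Sum>x\<in>Poly_Mapping.keys c. Poly_Mapping.lookup c x *
      of_int (Poly_Mapping.lookup (frag_extend g (f x)) z))"
  proof (rule sum.cong)
    fix x assume "x \<in> Poly_Mapping.keys c"
    then have "Poly_Mapping.lookup (frag_extend g (f x)) z =
        (\<Sum>y\<in>?Y. Poly_Mapping.lookup (f x) y * Poly_Mapping.lookup (g y) z)"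
      by (intro lookup_frag_extend) auto
    then show "(\<Sum>y\<in>?Y. Poly_Mapping.lookup c x * of_int (Poly_Mapping.lookup (f x) y) *
        of_int (Poly_Mapping.lookup (g y) z)) =
        Poly_Mapping.lookup c x * of_int (Poly_Mapping.lookup (frag_extend g (f x)) z)"
      by (simp add: sum_distrib_left mult.assoc)
  qed simp
  finally show "Poly_Mapping.lookup (base_change g (base_change f c)) z =
      Poly_Mapping.lookup (base_change (\<lambda>x. frag_extend g (f x)) c) z"
    by (simp add: lookup_base_change[OF finite_keys order_refl])
qed

lemma map_of_int_sum:
  "Poly_Mapping.map of_int (\<Sum>i\<in>I. frag_cmul (n i) (frag_of (g i))) =
     (\<Sum>i\<in>I. Poly_Mapping.single (g i) (of_int (n i) :: 'k::field))"
  by (rule poly_mapping_eqI) (auto simp: lookup_sum lookup_single when_def intro!: sum.cong)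

lemma singular_boundary_base_change:
  "singular_boundary p c = base_change (\<lambda>x. chain_boundary p (frag_of x)) c"
proof (cases "p = 0")
  case True
  then show ?thesis
    by (simp add: singular_boundary_def chain_boundary_def)
      (rule poly_mapping_eqI, simp add: lookup_base_change[OF finite_keys order_refl])
next
  case False
  have "Poly_Mapping.map of_int (chain_boundary p (frag_of x)) =
      (\<Sum>i\<le>p. Poly_Mapping.single (singular_face p i x) ((-1) ^ i) :: _ \<Rightarrow>\<^sub>0 'b)"
    for x :: "(nat \<Rightarrow> real) \<Rightarrow> 'a"
    using False by (simp add: chain_boundary_of map_of_int_sum del: sum.atMost_Suc)
  then show ?thesis using False by (simp add: singular_boundary_def base_change_def)
qed

lemma simplicial_boundary_base_change:
  "simplicial_boundary p c = base_change (\<lambda>x. simplex_boundary p (frag_of x)) c"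
proof (cases "p = 0")
  case True
  then show ?thesis
    by (simp add: simplicial_boundary_def simplex_boundary_def)
      (rule poly_mapping_eqI, simp add: lookup_base_change[OF finite_keys order_refl])
next
  case False
  have "Poly_Mapping.map of_int (simplex_boundary p (frag_of \<sigma>)) =
      (\<Sum>i\<le>p. Poly_Mapping.single (\<sigma> - {sorted_list_of_set \<sigma> ! i}) ((-1) ^ i) :: _ \<Rightarrow>\<^sub>0 'b)"
    for \<sigma> :: "'a set"
    using False by (simp add: simplex_boundary_of map_of_int_sum del: sum.atMost_Suc)
  then show ?thesis using False by (simp add: simplicial_boundary_def base_change_def)
qed

section \<open>Simplicial and singular homology over a field\<close>

lemma base_change_additive:
  assumes "\<And>c d. bd (c - d) = bd c - bd d"
  shows "base_change (\<lambda>y. bd (frag_of y)) (base_change f c) = base_change (\<lambda>x. bd (f x)) c"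
  unfolding base_change_base_change
  by (intro base_change_cong) (rule additive_expansion[of bd, OF assms, symmetric])

lemma base_change_chain_map:
  assumes bd': "\<And>c d. bd' (c - d) = bd' c - bd' d"
    and f: "\<And>x. x \<in> Poly_Mapping.keys c \<Longrightarrow> bd' (f x) = frag_extend f' (bd (frag_of x))"
  shows "base_change (\<lambda>y. bd' (frag_of y)) (base_change f c) =
    base_change f' (base_change (\<lambda>x. bd (frag_of x)) c)"
  unfolding base_change_additive[of bd', OF bd'] base_change_base_change
  using f by (intro base_change_cong)

text \<open>
A homotopy formula on basis elements over the integers holds for all chains over the field.
\<close>

lemma base_change_homotopy:
  assumes bd': "\<And>c d. bd' (c - d) = bd' c - bd' d"
    and h: "\<And>x. x \<in> Poly_Mapping.keys c \<Longrightarrow> bd' (h x) = f x - g x - frag_extend h' (bd (frag_of x))"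
  shows "base_change (\<lambda>y. bd' (frag_of y)) (base_change h c) =
    base_change f c - base_change g c - base_change h' (base_change (\<lambda>x. bd (frag_of x)) c)"
proof -
  have "base_change (\<lambda>y. bd' (frag_of y)) (base_change h c) =
      base_change (\<lambda>x. f x - g x - frag_extend h' (bd (frag_of x))) c"
    unfolding base_change_additive[of bd', OF bd'] using h by (intro base_change_cong)
  then show ?thesis by (simp add: base_change_diff_fun base_change_base_change)
qed

lemma singular_boundary_0 [simp]: "singular_boundary p 0 = 0"
  by (simp add: singular_boundary_base_change)

lemma keys_minus_subset:
  fixes a b :: "'a \<Rightarrow>\<^sub>0 'k::ab_group_add"
  shows "Poly_Mapping.keys (a - b) \<subseteq> Poly_Mapping.keys a \<union> Poly_Mapping.keys b"
  by (auto simp: in_keys_iff lookup_minus)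

lemma carrier_simplicial_chains: "carrier (simplicial_chains d A) = {c. Poly_Mapping.keys c \<subseteq> simplices A d}"
  by (simp add: simplicial_chains_def free_vs_def)

lemma carrier_singular_chains:
  "carrier (singular_chains d X) = {c. Poly_Mapping.keys c \<subseteq> singular_simplex_set d X}"
  by (simp add: singular_chains_def free_vs_def)

lemma base_change_geometric:
  fixes c :: "'v::linorder set \<Rightarrow>\<^sub>0 'k::field"
    and j :: "nat \<Rightarrow> 'v set \<Rightarrow> ((nat \<Rightarrow> real) \<Rightarrow> 'v \<Rightarrow> real) \<Rightarrow>\<^sub>0 int"
  assumes j: "geometric.carried_chain_map j" and A: "A \<subseteq> full_complex" "face_closed A"
    and c: "Poly_Mapping.keys c \<subseteq> simplices A p"
  shows "Poly_Mapping.keys (base_change (j p) c) \<subseteq> singular_simplex_set p (underlying_space A)"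
    and "singular_boundary p (base_change (j p) c) = base_change (j (p - 1)) (simplicial_boundary p c)"
proof -
  have j': "Poly_Mapping.keys (j p \<sigma>) \<subseteq> singular_simplex_set p (underlying_space (faces \<sigma>))"
    "chain_boundary p (j p \<sigma>) = frag_extend (j (p - 1)) (simplex_boundary p (frag_of \<sigma>))"
    if "\<sigma> \<in> Poly_Mapping.keys c" for \<sigma>
  proof -
    have "\<sigma> \<in> simplices full_complex p" using that A(1) c by auto
    then show "Poly_Mapping.keys (j p \<sigma>) \<subseteq> singular_simplex_set p (underlying_space (faces \<sigma>))"
      "chain_boundary p (j p \<sigma>) = frag_extend (j (p - 1)) (simplex_boundary p (frag_of \<sigma>))"
      using j unfolding geometric.carried_chain_map_def by blast+
  qed
  show "Poly_Mapping.keys (base_change (j p) c) \<subseteq> singular_simplex_set p (underlying_space A)"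
  proof (rule keys_base_change_subset)
    fix \<sigma> assume \<sigma>: "\<sigma> \<in> Poly_Mapping.keys c"
    then have "faces \<sigma> \<subseteq> A" using c A(2) by (auto simp: face_closed_def)
    then show "Poly_Mapping.keys (j p \<sigma>) \<subseteq> singular_simplex_set p (underlying_space A)"
      by (rule order_trans[OF j'(1)[OF \<sigma>] singular_simplex_set_underlying_space_mono])
  qed
  show "singular_boundary p (base_change (j p) c) = base_change (j (p - 1)) (simplicial_boundary p c)"
    unfolding singular_boundary_base_change simplicial_boundary_base_change
    by (rule base_change_chain_map[where bd' = "chain_boundary p" and bd = "simplex_boundary p",
          OF chain_boundary_diff j'(2)])
qed

lemma base_change_vertex:
  fixes c :: "((nat \<Rightarrow> real) \<Rightarrow> 'v::linorder \<Rightarrow> real) \<Rightarrow>\<^sub>0 'k::field"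
    and \<psi> :: "nat \<Rightarrow> ((nat \<Rightarrow> real) \<Rightarrow> 'v \<Rightarrow> real) \<Rightarrow> 'v set \<Rightarrow>\<^sub>0 int"
  assumes \<psi>: "vertex.carried_chain_map \<psi>" and A: "face_closed A"
    and c: "Poly_Mapping.keys c \<subseteq> small_simplices p"
    and cA: "Poly_Mapping.keys c \<subseteq> singular_simplex_set p (underlying_space A)"
  shows "Poly_Mapping.keys (base_change (\<psi> p) c) \<subseteq> simplices A p"
    and "simplicial_boundary p (base_change (\<psi> p) c) = base_change (\<psi> (p - 1)) (singular_boundary p c)"
proof -
  have \<psi>': "Poly_Mapping.keys (\<psi> p f) \<subseteq> simplices (faces (corner_vertices p f)) p"
    "simplex_boundary p (\<psi> p f) = frag_extend (\<psi> (p - 1)) (chain_boundary p (frag_of f))"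
    if "f \<in> Poly_Mapping.keys c" for f
    using \<psi> c that unfolding vertex.carried_chain_map_def by blast+
  show "Poly_Mapping.keys (base_change (\<psi> p) c) \<subseteq> simplices A p"
  proof (rule keys_base_change_subset)
    fix f assume f: "f \<in> Poly_Mapping.keys c"
    obtain x where x: "x \<in> standard_simplex p" using nonempty_standard_simplex by blast
    have "support (f x) \<in> A"
      using f cA x by (auto simp: singular_simplex_underlying_space topspace_underlying_space)
    then have "faces (support (f x)) \<subseteq> A" using A by (auto simp: face_closed_def)
    moreover have "corner_vertices p f \<subseteq> support (f x)"
      using c f x corner_vertices_support by blast
    ultimately have "faces (corner_vertices p f) \<subseteq> A" by auto
    then show "Poly_Mapping.keys (\<psi> p f) \<subseteq> simplices A p" using \<psi>'(1)[OF f] by blast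
  qed
  show "simplicial_boundary p (base_change (\<psi> p) c) = base_change (\<psi> (p - 1)) (singular_boundary p c)"
    unfolding singular_boundary_base_change simplicial_boundary_base_change
    by (rule base_change_chain_map[where bd' = "simplex_boundary p" and bd = "chain_boundary p",
          OF simplex_boundary_diff \<psi>'(2)])
qed

definition iterated_subdivision ::
  "nat \<Rightarrow> nat \<Rightarrow> (((nat \<Rightarrow> real) \<Rightarrow> 'a) \<Rightarrow>\<^sub>0 'k) \<Rightarrow> (((nat \<Rightarrow> real) \<Rightarrow> 'a) \<Rightarrow>\<^sub>0 'k::field)" where
  "iterated_subdivision m p = base_change (\<lambda>f. (singular_subdivision p ^^ m) (frag_of f))"

lemma iterated_subdivision_extend:
  "(singular_subdivision p ^^ m) c = frag_extend (\<lambda>f. (singular_subdivision p ^^ m) (frag_of f)) c"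
  by (rule additive_expansion) (rule singular_subdivision_power_diff)

lemma keys_iterated_subdivision:
  assumes "Poly_Mapping.keys c \<subseteq> singular_simplex_set p X"
  shows "Poly_Mapping.keys (iterated_subdivision m p c) \<subseteq> singular_simplex_set p X"
  unfolding iterated_subdivision_def
proof (rule keys_base_change_subset)
  fix f assume "f \<in> Poly_Mapping.keys c"
  then have "singular_chain p X (frag_of f)" using assms by (auto simp: singular_chain_of)
  from singular_chain_iterated_subdivision[OF this, of m]
  show "Poly_Mapping.keys ((singular_subdivision p ^^ m) (frag_of f)) \<subseteq> singular_simplex_set p X"
    by (simp add: singular_chain_def)
qed

lemma singular_boundary_iterated_subdivision:
  assumes "Poly_Mapping.keys c \<subseteq> singular_simplex_set p X"
  shows "singular_boundary p (iterated_subdivision m p c) =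
    iterated_subdivision m (p - 1) (singular_boundary p c)"
  unfolding singular_boundary_base_change iterated_subdivision_def
proof (rule base_change_chain_map[of "chain_boundary p", OF chain_boundary_diff])
  fix f assume "f \<in> Poly_Mapping.keys c"
  then have "singular_chain p X (frag_of f)" using assms by (auto simp: singular_chain_of)
  then show "chain_boundary p ((singular_subdivision p ^^ m) (frag_of f)) =
      frag_extend (\<lambda>f. (singular_subdivision (p - 1) ^^ m) (frag_of f)) (chain_boundary p (frag_of f))"
    by (simp add: chain_boundary_iterated_subdivision flip: iterated_subdivision_extend)
qed

lemma iterated_subdivision_eventually_small:
  fixes A :: "'v set set"
  assumes A: "A \<subseteq> full_complex" "finite A"
    and c: "Poly_Mapping.keys c \<subseteq> singular_simplex_set p (underlying_space A)"
  shows "\<forall>\<^sub>F m in sequentially. Poly_Mapping.keys (iterated_subdivision m p c) \<subseteq> small_simplices p"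
proof -
  have "\<forall>\<^sub>F m in sequentially. \<forall>f\<in>Poly_Mapping.keys c.
      Poly_Mapping.keys ((singular_subdivision p ^^ m) (frag_of f)) \<subseteq> small_simplices p"
    using c by (intro eventually_ball_finite ballI subdivision_eventually_small[OF A])
      (auto simp: singular_chain_of)
  then show ?thesis
    by (rule eventually_mono) (auto simp: iterated_subdivision_def dest!: keys_base_change[THEN subsetD])
qed

text \<open>
The natural integral homotopy between iterated subdivision and the identity, with scalars extended.
\<close>

lemma iterated_subdivision_homologous:
  assumes c: "Poly_Mapping.keys c \<subseteq> singular_simplex_set p X" and cyc: "singular_boundary p c = 0"
  shows "\<exists>w. Poly_Mapping.keys w \<subseteq> singular_simplex_set (Suc p) X \<and>
    singular_boundary (Suc p) w = iterated_subdivision m p c - c"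
proof -
  obtain D where
    D_diff: "\<And>p c1 c2. D p (c1 - c2) = D p c1 - D p (c2 :: 'a chain)"
    and D_chain: "\<And>p X c. singular_chain p X c \<Longrightarrow> singular_chain (Suc p) X (D p (c :: 'a chain))"
    and D_bd: "\<And>p X c. singular_chain p X c \<Longrightarrow>
       chain_boundary (Suc p) (D p c) + D (p - Suc 0) (chain_boundary p c) =
         (singular_subdivision p ^^ m) c - (c :: 'a chain)"
    by (rule chain_homotopic_iterated_singular_subdivision[where n = m]) (rule that; assumption)
  let ?w = "base_change (\<lambda>f. D p (frag_of f)) c"
  have of: "singular_chain p X (frag_of f)" if "f \<in> Poly_Mapping.keys c" for f
    using that c by (auto simp: singular_chain_of)
  have "singular_boundary (Suc p) ?w = iterated_subdivision m p c - base_change frag_of c -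
      base_change (\<lambda>f. D (p - 1) (frag_of f)) (singular_boundary p c)"
    unfolding singular_boundary_base_change iterated_subdivision_def
  proof (rule base_change_homotopy[of "chain_boundary (Suc p)", OF chain_boundary_diff])
    fix f assume "f \<in> Poly_Mapping.keys c"
    then show "chain_boundary (Suc p) (D p (frag_of f)) = (singular_subdivision p ^^ m) (frag_of f) -
        frag_of f - frag_extend (\<lambda>f. D (p - 1) (frag_of f)) (chain_boundary p (frag_of f))"
      using D_bd[OF of] by (simp add: algebra_simps flip: additive_expansion[of "D (p - Suc 0)", OF D_diff])
  qed
  moreover have "Poly_Mapping.keys ?w \<subseteq> singular_simplex_set (Suc p) X"
    by (intro keys_base_change_subset) (use D_chain[OF of] in \<open>auto simp: singular_chain_def\<close>)
  ultimately show ?thesis using cyc by (intro exI[of _ ?w]) simp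
qed

text \<open>
A cycle is homologous to a small one by subdivision, and a small cycle is homologous to the image of the
simplicial cycle on its corner vertices.
\<close>

lemma geometric_surjective_on_homology:
  fixes c :: "((nat \<Rightarrow> real) \<Rightarrow> 'v::linorder \<Rightarrow> real) \<Rightarrow>\<^sub>0 'k::field"
    and j :: "nat \<Rightarrow> 'v set \<Rightarrow> ((nat \<Rightarrow> real) \<Rightarrow> 'v \<Rightarrow> real) \<Rightarrow>\<^sub>0 int"
    and \<psi> :: "nat \<Rightarrow> ((nat \<Rightarrow> real) \<Rightarrow> 'v \<Rightarrow> real) \<Rightarrow> 'v set \<Rightarrow>\<^sub>0 int"
  assumes j: "geometric.carried_chain_map j" and \<psi>: "vertex.carried_chain_map \<psi>"
    and A: "A \<subseteq> full_complex" "face_closed A" "finite A"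
    and c: "c \<in> singular_cycles p (underlying_space A)"
  shows "\<exists>z\<in>simplicial_cycles p A. c - base_change (j p) z \<in> singular_boundaries p (underlying_space A)"
proof -
  let ?X = "underlying_space A"
  have cX: "Poly_Mapping.keys c \<subseteq> singular_simplex_set p ?X" and cyc: "singular_boundary p c = 0"
    using c by (auto simp: singular_cycles_def carrier_singular_chains)
  from iterated_subdivision_eventually_small[OF A(1,3) cX]
  obtain m where small: "Poly_Mapping.keys (iterated_subdivision m p c) \<subseteq> small_simplices p"
    by (auto simp: eventually_sequentially)
  let ?c = "iterated_subdivision m p c"
  have cX': "Poly_Mapping.keys ?c \<subseteq> singular_simplex_set p ?X"
    by (rule keys_iterated_subdivision[OF cX])
  have cyc': "singular_boundary p ?c = 0"
    by (simp add: singular_boundary_iterated_subdivision[OF cX] cyc) (simp add: iterated_subdivision_def)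
  obtain w where w: "Poly_Mapping.keys w \<subseteq> singular_simplex_set (Suc p) ?X"
    "singular_boundary (Suc p) w = ?c - c"
    using iterated_subdivision_homologous[OF cX cyc] by blast
  let ?z = "base_change (\<psi> p) ?c"
  have z: "?z \<in> simplicial_cycles p A"
    using base_change_vertex[OF \<psi> A(2) small cX'] cyc'
    by (simp add: simplicial_cycles_def carrier_simplicial_chains)
  obtain h where h: "\<And>p f. small_simplex p f \<Longrightarrow>
     Poly_Mapping.keys (h p f) \<subseteq> singular_simplex_set (Suc p) (underlying_space (supports_complex p f))"
    "\<And>p f. small_simplex p f \<Longrightarrow> chain_boundary (Suc p) (h p f) =
       frag_extend (j p) (\<psi> p f) - frag_of f - frag_extend (h (p - 1)) (chain_boundary p (frag_of f))"
    using geometric_vertex_homotopy[OF j \<psi>] by blast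
  let ?v = "base_change (h p) ?c"
  have "singular_boundary (Suc p) ?v = base_change (\<lambda>f. frag_extend (j p) (\<psi> p f)) ?c -
      base_change frag_of ?c - base_change (h (p - 1)) (singular_boundary p ?c)"
    unfolding singular_boundary_base_change
    using small
    by (intro base_change_homotopy[of "chain_boundary (Suc p)", OF chain_boundary_diff] h(2)) blast
  then have v: "singular_boundary (Suc p) ?v = base_change (j p) ?z - ?c"
    by (simp add: cyc' base_change_base_change)
  have vX: "Poly_Mapping.keys ?v \<subseteq> singular_simplex_set (Suc p) ?X"
  proof (rule keys_base_change_subset)
    fix f assume f: "f \<in> Poly_Mapping.keys ?c"
    have "supports_complex p f \<subseteq> A"
    proof
      fix \<tau> assume "\<tau> \<in> supports_complex p f"
      then obtain x where "\<tau> \<noteq> {}" "x \<in> standard_simplex p" "\<tau> \<subseteq> support (f x)"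
        by (auto simp: supports_complex_def)
      moreover from this have "support (f x) \<in> A"
        using cX' f by (auto simp: singular_simplex_underlying_space topspace_underlying_space)
      ultimately show "\<tau> \<in> A" using A(2) unfolding face_closed_def by blast
    qed
    then show "Poly_Mapping.keys (h p f) \<subseteq> singular_simplex_set (Suc p) ?X"
      by (rule order_trans[OF h(1)[OF CollectD[OF subsetD[OF small f]]]
            singular_simplex_set_underlying_space_mono])
  qed
  have "c - base_change (j p) ?z = singular_boundary (Suc p) (0 - (w + ?v))"
    unfolding singular_boundary_base_change base_change_diff base_change_add
    unfolding singular_boundary_base_change[symmetric] by (simp add: w(2) v)
  moreover have "Poly_Mapping.keys (0 - (w + ?v)) \<subseteq> singular_simplex_set (Suc p) ?X"
    using w(1) vX keys_add[of w ?v] keys_minus_subset[of 0 "w + ?v"] by auto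
  ultimately have "c - base_change (j p) ?z \<in> singular_boundaries p ?X"
    by (auto simp: singular_boundaries_def carrier_singular_chains)
  then show ?thesis using z by blast
qed

text \<open>
If the image of \<open>z\<close> bounds a singular chain \<open>w\<close>, subdivide so often that \<open>w\<close> and the images of all
simplices of the finite complex become small. The corner vertices of the subdivided \<open>w\<close> give a
simplicial chain that bounds a cycle homologous to \<open>z\<close>.
\<close>

lemma geometric_injective_on_homology:
  fixes z :: "'v::linorder set \<Rightarrow>\<^sub>0 'k::field"
    and j :: "nat \<Rightarrow> 'v set \<Rightarrow> ((nat \<Rightarrow> real) \<Rightarrow> 'v \<Rightarrow> real) \<Rightarrow>\<^sub>0 int"
    and \<psi> :: "nat \<Rightarrow> ((nat \<Rightarrow> real) \<Rightarrow> 'v \<Rightarrow> real) \<Rightarrow> 'v set \<Rightarrow>\<^sub>0 int"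
  assumes j: "geometric.carried_chain_map j" and \<psi>: "vertex.carried_chain_map \<psi>"
    and A: "A \<subseteq> full_complex" "face_closed A" "finite A"
    and z: "z \<in> simplicial_cycles p A"
    and bound: "base_change (j p) z \<in> singular_boundaries p (underlying_space A)"
  shows "z \<in> simplicial_boundaries p A"
proof -
  let ?X = "underlying_space A"
  have zA: "Poly_Mapping.keys z \<subseteq> simplices A p" and cyc: "simplicial_boundary p z = 0"
    using z by (auto simp: simplicial_cycles_def carrier_simplicial_chains)
  obtain w where wX: "Poly_Mapping.keys w \<subseteq> singular_simplex_set (Suc p) ?X"
    and w: "base_change (j p) z = singular_boundary (Suc p) w"
    using bound by (auto simp: singular_boundaries_def carrier_singular_chains)
  have jA: "singular_chain (card \<sigma> - 1) ?X (j (card \<sigma> - 1) \<sigma>)" if \<sigma>: "\<sigma> \<in> A" for \<sigma>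
  proof -
    have "\<sigma> \<in> simplices full_complex (card \<sigma> - 1)"
      using \<sigma> A(1) card_gt_0_iff[of \<sigma>] by auto
    then have "Poly_Mapping.keys (j (card \<sigma> - 1) \<sigma>)
        \<subseteq> singular_simplex_set (card \<sigma> - 1) (underlying_space (faces \<sigma>))"
      using j unfolding geometric.carried_chain_map_def by blast
    moreover have "singular_simplex_set (card \<sigma> - 1) (underlying_space (faces \<sigma>))
        \<subseteq> singular_simplex_set (card \<sigma> - 1) ?X"
      using \<sigma> A(2) by (intro singular_simplex_set_underlying_space_mono) (auto simp: face_closed_def)
    ultimately show ?thesis unfolding singular_chain_def by (rule order_trans)
  qed
  \<comment> \<open>Each simplex of \<open>A\<close> occurs in the single degree \<open>card \<sigma> - 1\<close>, so finitely many chains have to become small.\<close>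
  have "\<forall>\<^sub>F m in sequentially. \<forall>\<sigma>\<in>A. Poly_Mapping.keys
      ((singular_subdivision (card \<sigma> - 1) ^^ m) (j (card \<sigma> - 1) \<sigma>)) \<subseteq> small_simplices (card \<sigma> - 1)"
    using A(3) jA by (intro eventually_ball_finite ballI subdivision_eventually_small[OF A(1,3)])
  with iterated_subdivision_eventually_small[OF A(1,3) wX]
  have "\<forall>\<^sub>F m in sequentially.
      Poly_Mapping.keys (iterated_subdivision m (Suc p) w) \<subseteq> small_simplices (Suc p) \<and>
      (\<forall>\<sigma>\<in>A. Poly_Mapping.keys
      ((singular_subdivision (card \<sigma> - 1) ^^ m) (j (card \<sigma> - 1) \<sigma>)) \<subseteq> small_simplices (card \<sigma> - 1))"
    by (rule eventually_conj)
  then obtain m where small_w: "Poly_Mapping.keys (iterated_subdivision m (Suc p) w) \<subseteq> small_simplices (Suc p)"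
    and small: "\<And>\<sigma>. \<sigma> \<in> A \<Longrightarrow> Poly_Mapping.keys
      ((singular_subdivision (card \<sigma> - 1) ^^ m) (j (card \<sigma> - 1) \<sigma>)) \<subseteq> small_simplices (card \<sigma> - 1)"
    unfolding eventually_sequentially by blast
  have small': "Poly_Mapping.keys ((singular_subdivision q ^^ m) (j q \<sigma>)) \<subseteq> small_simplices q"
    if "\<sigma> \<in> simplices A q" for q \<sigma>
    using small[of \<sigma>] that by simp
  obtain h where h: "\<And>q \<sigma>. \<sigma> \<in> simplices A q \<Longrightarrow>
      Poly_Mapping.keys (h q \<sigma>) \<subseteq> simplices (faces \<sigma>) (Suc q)"
    "\<And>q \<sigma>. \<sigma> \<in> simplices A q \<Longrightarrow> simplex_boundary (Suc q) (h q \<sigma>) =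
       frag_extend (\<psi> q) ((singular_subdivision q ^^ m) (j q \<sigma>)) - frag_of \<sigma>
         - frag_extend (h (q - 1)) (simplex_boundary q (frag_of \<sigma>))"
    using vertex_geometric_homotopy[OF j \<psi> A(1,2) small'] by blast
  let ?F = "\<lambda>\<sigma>. frag_extend (\<psi> p) ((singular_subdivision p ^^ m) (j p \<sigma>))"
  let ?w = "iterated_subdivision m (Suc p) w"
  have "simplicial_boundary (Suc p) (base_change (h p) z) = base_change ?F z -
      base_change frag_of z - base_change (h (p - 1)) (simplicial_boundary p z)"
    unfolding simplicial_boundary_base_change
    using zA
    by (intro base_change_homotopy[of "simplex_boundary (Suc p)", OF simplex_boundary_diff] h(2)) blast
  then have 1: "simplicial_boundary (Suc p) (base_change (h p) z) = base_change ?F z - z"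
    by (simp add: cyc)
  have "base_change ?F z = base_change (\<psi> p) (iterated_subdivision m p (base_change (j p) z))"
    unfolding iterated_subdivision_def base_change_base_change
    by (simp flip: iterated_subdivision_extend)
  also have "\<dots> = base_change (\<psi> p) (singular_boundary (Suc p) ?w)"
    by (simp add: w singular_boundary_iterated_subdivision[OF wX])
  also have "\<dots> = simplicial_boundary (Suc p) (base_change (\<psi> (Suc p)) ?w)"
    using base_change_vertex(2)[OF \<psi> A(2) small_w keys_iterated_subdivision[OF wX]] by simp
  finally have 2: "base_change ?F z = simplicial_boundary (Suc p) (base_change (\<psi> (Suc p)) ?w)" .
  let ?v = "base_change (\<psi> (Suc p)) ?w - base_change (h p) z"
  have "z = simplicial_boundary (Suc p) ?v"
    unfolding simplicial_boundary_base_change base_change_diff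
    unfolding simplicial_boundary_base_change[symmetric] by (simp add: 1 2[symmetric])
  moreover have "Poly_Mapping.keys ?v \<subseteq> simplices A (Suc p)"
  proof -
    have "Poly_Mapping.keys (base_change (h p) z) \<subseteq> simplices A (Suc p)"
    proof (rule keys_base_change_subset)
      fix \<sigma> assume \<sigma>: "\<sigma> \<in> Poly_Mapping.keys z"
      then have "faces \<sigma> \<subseteq> A" using zA A(2) by (auto simp: face_closed_def)
      then show "Poly_Mapping.keys (h p \<sigma>) \<subseteq> simplices A (Suc p)" using h(1)[of \<sigma> p] \<sigma> zA by blast
    qed
    moreover have "Poly_Mapping.keys (base_change (\<psi> (Suc p)) ?w) \<subseteq> simplices A (Suc p)"
      by (rule base_change_vertex(1)[OF \<psi> A(2) small_w keys_iterated_subdivision[OF wX]])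
    ultimately show ?thesis
      using keys_minus_subset[of "base_change (\<psi> (Suc p)) ?w" "base_change (h p) z"] by blast
  qed
  ultimately show ?thesis
    unfolding simplicial_boundaries_def carrier_simplicial_chains by blast
qed

text \<open>
Simplicial and singular homology agree for finite complexes. The map is the same for all complexes,
which is its naturality for inclusions.
\<close>

theorem simplicial_singular_comparison:
  "\<exists>J :: ('v::linorder set \<Rightarrow>\<^sub>0 'k::field) \<Rightarrow> (((nat \<Rightarrow> real) \<Rightarrow> 'v \<Rightarrow> real) \<Rightarrow>\<^sub>0 'k).
     (\<forall>c c'. J (c + c') = J c + J c') \<and>
     (\<forall>r c. J (Poly_Mapping.map ((*) r) c) = Poly_Mapping.map ((*) r) (J c)) \<and>
     (\<forall>A. A \<subseteq> full_complex \<and> face_closed A \<and> finite A \<longrightarrow>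
       (\<forall>z\<in>simplicial_cycles d A. J z \<in> singular_cycles d (underlying_space A) \<and>
          (J z \<in> singular_boundaries d (underlying_space A) \<longleftrightarrow> z \<in> simplicial_boundaries d A)) \<and>
       (\<forall>c\<in>singular_cycles d (underlying_space A).
          \<exists>z\<in>simplicial_cycles d A. c - J z \<in> singular_boundaries d (underlying_space A)))"
proof -
  obtain j :: "nat \<Rightarrow> 'v set \<Rightarrow> ((nat \<Rightarrow> real) \<Rightarrow> 'v \<Rightarrow> real) \<Rightarrow>\<^sub>0 int"
    where j: "geometric.carried_chain_map j" using geometric_chain_map_exists by blast
  obtain \<psi> :: "nat \<Rightarrow> ((nat \<Rightarrow> real) \<Rightarrow> 'v \<Rightarrow> real) \<Rightarrow> 'v set \<Rightarrow>\<^sub>0 int"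
    where \<psi>: "vertex.carried_chain_map \<psi>" using vertex_chain_map_exists by blast
  let ?J = "base_change (j d) :: ('v set \<Rightarrow>\<^sub>0 'k) \<Rightarrow> _"
  show ?thesis
  proof (intro exI[of _ ?J] conjI allI impI ballI)
    show "?J (c + c') = ?J c + ?J c'" for c c' by (rule base_change_add)
    show "?J (Poly_Mapping.map ((*) r) c) = Poly_Mapping.map ((*) r) (?J c)" for r c
      by (rule base_change_smult)
    fix A :: "'v set set" assume "A \<subseteq> full_complex \<and> face_closed A \<and> finite A"
    then have A: "A \<subseteq> full_complex" "face_closed A" "finite A" by auto
    show "\<exists>z\<in>simplicial_cycles d A. c - ?J z \<in> singular_boundaries d (underlying_space A)"
      if "c \<in> singular_cycles d (underlying_space A)" for c
      using geometric_surjective_on_homology[OF j \<psi> A that] .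
    fix z :: "'v set \<Rightarrow>\<^sub>0 'k" assume z: "z \<in> simplicial_cycles d A"
    then have zA: "Poly_Mapping.keys z \<subseteq> simplices A d" and cyc: "simplicial_boundary d z = 0"
      by (auto simp: simplicial_cycles_def carrier_simplicial_chains)
    show "?J z \<in> singular_cycles d (underlying_space A)"
      using base_change_geometric[OF j A(1,2) zA] cyc
      by (simp add: singular_cycles_def carrier_singular_chains)
    show "?J z \<in> singular_boundaries d (underlying_space A) \<longleftrightarrow> z \<in> simplicial_boundaries d A"
    proof
      show "z \<in> simplicial_boundaries d A" if "?J z \<in> singular_boundaries d (underlying_space A)"
        by (rule geometric_injective_on_homology[OF j \<psi> A z that])
    next
      assume "z \<in> simplicial_boundaries d A"
      then obtain w where w: "Poly_Mapping.keys w \<subseteq> simplices A (Suc d)" "z = simplicial_boundary (Suc d) w"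
        by (auto simp: simplicial_boundaries_def carrier_simplicial_chains)
      then show "?J z \<in> singular_boundaries d (underlying_space A)"
        using base_change_geometric[OF j A(1,2) w(1)]
        unfolding singular_boundaries_def carrier_singular_chains by (intro image_eqI) auto
    qed
  qed
qed

section \<open>Cosets of cycles and the homology module\<close>

text \<open>
A linearly independent subset of the subspace has at most \<open>dim\<close> elements, so there is a maximal one,
and it is a basis.
\<close>

lemma (in vectorspace) subspace_fin_dim:
  assumes fd: "fin_dim" and sub: "VectorSpace.subspace K W V"
  shows "vectorspace.fin_dim K (vs W)"
proof -
  interpret W: vectorspace K "vs W" by (rule subspace_is_vs[OF sub])
  have subm: "submodule K W V" using sub by simp
  then have WV: "W \<subseteq> carrier V" by (simp add: submodule_def)
  have small: "finite A \<and> card A \<le> dim" if "A \<subseteq> W" "W.lin_indpt A" for A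
  proof -
    have "lin_indpt A" using span_li_not_depend(2)[OF that(1) subm] that(2) by simp
    then show ?thesis using li_le_dim[OF fd, of A] that(1) WV by blast
  qed
  have "W.lin_indpt {}" unfolding W.lin_dep_def by auto
  then obtain A where A: "finite A" "maximal A (\<lambda>S. S \<subseteq> carrier (vs W) \<and> W.lin_indpt S)"
    using maximal_exists[of "\<lambda>S. S \<subseteq> carrier (vs W) \<and> W.lin_indpt S" dim "{}"] small by auto
  from W.max_li_is_basis[OF A(2)] show ?thesis
    unfolding W.fin_dim_def W.basis_def using A(1) by blast
qed

lemma map_mult_simps:
  fixes v w :: "'b \<Rightarrow>\<^sub>0 'k::field"
  shows "Poly_Mapping.map ((*) (r * s)) v = Poly_Mapping.map ((*) r) (Poly_Mapping.map ((*) s) v)"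
    "Poly_Mapping.map ((*) 1) v = v"
    "Poly_Mapping.map ((*) (r + s)) v = Poly_Mapping.map ((*) r) v + Poly_Mapping.map ((*) s) v"
    "Poly_Mapping.map ((*) r) (v + w) = Poly_Mapping.map ((*) r) v + Poly_Mapping.map ((*) r) w"
    "Poly_Mapping.map ((*) (- 1)) v = - v"
    "Poly_Mapping.map ((*) r) 0 = (0 :: 'b \<Rightarrow>\<^sub>0 'k)"
  by (rule poly_mapping_eqI; simp add: lookup_add algebra_simps)+

lemma keys_map_mult:
  "Poly_Mapping.keys (Poly_Mapping.map ((*) (r :: 'k::field)) v) \<subseteq> Poly_Mapping.keys v"
  by (auto simp: in_keys_iff)

lemma free_vs_vectorspace: "vectorspace class_ring (free_vs B :: ('k::field, 'b \<Rightarrow>\<^sub>0 'k) module)"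
proof (rule vs_criteria)
  show "field (class_ring :: 'k ring)" by (rule class_field)
  show "\<forall>v w. v \<in> carrier (free_vs B :: ('k, 'b \<Rightarrow>\<^sub>0 'k) module) \<and> w \<in> carrier (free_vs B :: ('k, 'b \<Rightarrow>\<^sub>0 'k) module)
      \<longrightarrow> v \<oplus>\<^bsub>(free_vs B :: ('k, 'b \<Rightarrow>\<^sub>0 'k) module)\<^esub> w \<in> carrier (free_vs B :: ('k, 'b \<Rightarrow>\<^sub>0 'k) module)"
    using keys_add by (fastforce simp: free_vs_def)
  show "\<forall>v\<in>carrier (free_vs B :: ('k, 'b \<Rightarrow>\<^sub>0 'k) module). \<exists>neg_v\<in>carrier (free_vs B :: ('k, 'b \<Rightarrow>\<^sub>0 'k) module).
      v \<oplus>\<^bsub>(free_vs B :: ('k, 'b \<Rightarrow>\<^sub>0 'k) module)\<^esub> neg_v = \<zero>\<^bsub>(free_vs B :: ('k, 'b \<Rightarrow>\<^sub>0 'k) module)\<^esub>"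
  proof
    fix v :: "'b \<Rightarrow>\<^sub>0 'k" assume "v \<in> carrier (free_vs B :: ('k, 'b \<Rightarrow>\<^sub>0 'k) module)"
    moreover have "Poly_Mapping.keys (- v) = Poly_Mapping.keys v" by (auto simp: in_keys_iff)
    ultimately show "\<exists>neg_v\<in>carrier (free_vs B :: ('k, 'b \<Rightarrow>\<^sub>0 'k) module).
        v \<oplus>\<^bsub>(free_vs B :: ('k, 'b \<Rightarrow>\<^sub>0 'k) module)\<^esub> neg_v = \<zero>\<^bsub>(free_vs B :: ('k, 'b \<Rightarrow>\<^sub>0 'k) module)\<^esub>"
      by (intro bexI[of _ "- v"]) (auto simp: free_vs_def)
  qed
qed (auto simp: free_vs_def map_mult_simps algebra_simps dest: keys_map_mult[THEN subsetD])

lemma free_vs_fin_dim: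
  assumes fin: "finite B"
  shows "vectorspace.fin_dim class_ring (free_vs B :: ('k::field, 'b \<Rightarrow>\<^sub>0 'k) module)"
proof -
  interpret V: vectorspace class_ring "free_vs B :: ('k, 'b \<Rightarrow>\<^sub>0 'k) module" by (rule free_vs_vectorspace)
  let ?S = "(\<lambda>b. Poly_Mapping.single b (1::'k)) ` B"
  have S: "?S \<subseteq> carrier (free_vs B :: ('k, 'b \<Rightarrow>\<^sub>0 'k) module)" by (auto simp: free_vs_def)
  have sub: "submodule class_ring (V.span ?S) (free_vs B :: ('k, 'b \<Rightarrow>\<^sub>0 'k) module)"
    by (rule V.span_is_submodule[OF S])
  have "c \<in> V.span ?S" if c: "c \<in> carrier (free_vs B :: ('k, 'b \<Rightarrow>\<^sub>0 'k) module)" for c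
  proof -
    have partial: "(\<Sum>b\<in>T. Poly_Mapping.map ((*) (Poly_Mapping.lookup c b)) (Poly_Mapping.single b 1)) \<in> V.span ?S"
      if "T \<subseteq> B" for T
      using finite_subset[OF that fin] that
    proof (induction T rule: finite_induct)
      case empty
      then show ?case using submodule.zero_closed[OF sub] by (simp add: free_vs_def)
    next
      case (insert b T)
      have "Poly_Mapping.single b (1::'k) \<in> V.span ?S"
        using V.in_own_span[OF S] insert.prems by auto
      from submodule.smult_closed[OF sub _ this, of "Poly_Mapping.lookup c b"]
      have "Poly_Mapping.map ((*) (Poly_Mapping.lookup c b)) (Poly_Mapping.single b 1) \<in> V.span ?S"
        by (simp add: free_vs_def)
      from submodule.m_closed[OF sub this] insert
      show ?case by (simp add: free_vs_def)
    qed
    have "c = (\<Sum>b\<in>B. Poly_Mapping.map ((*) (Poly_Mapping.lookup c b)) (Poly_Mapping.single b 1))"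
    proof (rule poly_mapping_eqI)
      fix y
      have "Poly_Mapping.lookup (\<Sum>b\<in>B. Poly_Mapping.map ((*) (Poly_Mapping.lookup c b)) (Poly_Mapping.single b 1)) y =
          (\<Sum>b\<in>B. if b = y then Poly_Mapping.lookup c b else 0)"
        unfolding lookup_sum by (intro sum.cong) (auto simp: lookup_single when_def)
      also have "\<dots> = Poly_Mapping.lookup c y"
        using c fin by (auto simp: free_vs_def in_keys_iff)
      finally show "Poly_Mapping.lookup c y =
          Poly_Mapping.lookup (\<Sum>b\<in>B. Poly_Mapping.map ((*) (Poly_Mapping.lookup c b)) (Poly_Mapping.single b 1)) y"
        by simp
    qed
    then show ?thesis using partial[OF order_refl] by simp
  qed
  then have "carrier (free_vs B :: ('k, 'b \<Rightarrow>\<^sub>0 'k) module) = V.span ?S"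
    using V.span_is_subset2[OF S] by blast
  then show ?thesis unfolding V.fin_dim_def using S fin by blast
qed

lemma simplicial_cycles_subspace:
  "VectorSpace.subspace class_ring (simplicial_cycles d A :: ('v::linorder set \<Rightarrow>\<^sub>0 'k::field) set) (simplicial_chains d A)"
proof -
  interpret V: vectorspace class_ring "simplicial_chains d A :: ('k, 'v set \<Rightarrow>\<^sub>0 'k) module"
    unfolding simplicial_chains_def by (rule free_vs_vectorspace)
  have "submodule class_ring (simplicial_cycles d A :: ('v set \<Rightarrow>\<^sub>0 'k) set) (simplicial_chains d A)"
  proof
    show "simplicial_cycles d A \<subseteq> carrier (simplicial_chains d A :: ('k, 'v set \<Rightarrow>\<^sub>0 'k) module)"
      by (auto simp: simplicial_cycles_def)
    fix v w :: "'v set \<Rightarrow>\<^sub>0 'k" assume v: "v \<in> simplicial_cycles d A"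
    show "c \<odot>\<^bsub>simplicial_chains d A\<^esub> v \<in> simplicial_cycles d A" for c
      using v keys_map_mult[of c v]
      by (auto simp: simplicial_cycles_def simplicial_chains_def free_vs_def
          simplicial_boundary_base_change base_change_smult map_mult_simps)
    assume w: "w \<in> simplicial_cycles d A"
    show "v \<oplus>\<^bsub>simplicial_chains d A\<^esub> w \<in> simplicial_cycles d A"
      using v w keys_add[of v w]
      by (auto simp: simplicial_cycles_def simplicial_chains_def free_vs_def
          simplicial_boundary_base_change base_change_add)
  qed (auto simp: simplicial_cycles_def simplicial_chains_def free_vs_def simplicial_boundary_base_change)
  then show ?thesis by (simp add: VectorSpace.subspace_def V.vectorspace_axioms)
qed

text \<open>
The class of a cycle \<open>x\<close> in homology, as a set of chains.
\<close>

definition coset :: "('b \<Rightarrow>\<^sub>0 'k::field) set \<Rightarrow> ('b \<Rightarrow>\<^sub>0 'k) \<Rightarrow> ('b \<Rightarrow>\<^sub>0 'k) set" where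
  "coset W x = (\<lambda>w. w + x) ` W"

definition linear_subset :: "('b \<Rightarrow>\<^sub>0 'k::field) set \<Rightarrow> bool" where
  "linear_subset W \<longleftrightarrow> 0 \<in> W \<and> (\<forall>x\<in>W. \<forall>y\<in>W. x + y \<in> W) \<and>
     (\<forall>r. \<forall>x\<in>W. Poly_Mapping.map ((*) r) x \<in> W)"

lemma linear_subset_diff: "linear_subset W \<Longrightarrow> x \<in> W \<Longrightarrow> y \<in> W \<Longrightarrow> x - y \<in> W"
  unfolding linear_subset_def by (metis map_mult_simps(5) diff_conv_add_uminus)

lemma coset_eq_iff:
  assumes "linear_subset W"
  shows "coset W x = coset W y \<longleftrightarrow> x - y \<in> W"
proof
  assume eq: "coset W x = coset W y"
  have "0 \<in> W" using assms by (simp add: linear_subset_def)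
  then have "0 + x \<in> coset W x" unfolding coset_def by (rule imageI)
  then obtain w where "w \<in> W" "x = w + y" unfolding eq by (auto simp: coset_def)
  then show "x - y \<in> W" by simp
next
  have *: "coset W x \<subseteq> coset W y" if "x - y \<in> W" for x y
  proof
    fix z assume "z \<in> coset W x"
    then obtain w where w: "w \<in> W" "z = w + x" by (auto simp: coset_def)
    have "w + (x - y) \<in> W" using w(1) that assms by (simp add: linear_subset_def)
    then show "z \<in> coset W y" unfolding coset_def by (rule rev_image_eqI) (simp add: w(2))
  qed
  assume xy: "x - y \<in> W"
  have "0 \<in> W" using assms by (simp add: linear_subset_def)
  from linear_subset_diff[OF assms this xy] have "y - x \<in> W" by simp
  then show "coset W x = coset W y" using *[OF xy] *[of y x] by simp
qed

lemma coset_eq_self_iff: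
  assumes "linear_subset W"
  shows "coset W x = W \<longleftrightarrow> x \<in> W"
  using coset_eq_iff[OF assms, of x 0] by (simp add: coset_def)

lemma a_r_coset_coset:
  "add V = (+) \<Longrightarrow> W +>\<^bsub>V\<^esub> x = coset W x"
  by (auto simp: a_r_coset_def' coset_def)

lemma singular_boundaries_closed:
  "linear_subset (singular_boundaries d X :: (((nat \<Rightarrow> real) \<Rightarrow> 'a) \<Rightarrow>\<^sub>0 'k::field) set)"
proof -
  let ?W = "singular_boundaries d X :: (((nat \<Rightarrow> real) \<Rightarrow> 'a) \<Rightarrow>\<^sub>0 'k) set"
  let ?C = "carrier (singular_chains (Suc d) X) :: (((nat \<Rightarrow> real) \<Rightarrow> 'a) \<Rightarrow>\<^sub>0 'k) set"
  have add: "v + w \<in> ?C" if "v \<in> ?C" "w \<in> ?C" for v w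
    using that keys_add[of v w] by (auto simp: carrier_singular_chains)
  have smult: "Poly_Mapping.map ((*) r) v \<in> ?C" if "v \<in> ?C" for r v
    using that keys_map_mult[of r v] by (auto simp: carrier_singular_chains)
  have "0 \<in> ?W"
    unfolding singular_boundaries_def by (rule image_eqI[of _ _ 0]) (auto simp: carrier_singular_chains)
  moreover have "x + y \<in> ?W" if x: "x \<in> ?W" and y: "y \<in> ?W" for x y
  proof -
    obtain v where v: "v \<in> ?C" "x = singular_boundary (Suc d) v"
      using x by (auto simp: singular_boundaries_def)
    obtain w where w: "w \<in> ?C" "y = singular_boundary (Suc d) w"
      using y by (auto simp: singular_boundaries_def)
    show ?thesis unfolding singular_boundaries_def
      by (rule image_eqI[of _ _ "v + w"])
        (simp_all add: v w add singular_boundary_base_change base_change_add)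
  qed
  moreover have "Poly_Mapping.map ((*) r) x \<in> ?W" if x: "x \<in> ?W" for r x
  proof -
    obtain v where v: "v \<in> ?C" "x = singular_boundary (Suc d) v"
      using x by (auto simp: singular_boundaries_def)
    show ?thesis unfolding singular_boundaries_def
      by (rule image_eqI[of _ _ "Poly_Mapping.map ((*) r) v"])
        (simp_all add: v smult singular_boundary_base_change base_change_smult)
  qed
  ultimately show ?thesis unfolding linear_subset_def by blast
qed

lemma singular_homology_simps:
  fixes X :: "'a topology" and d :: nat
  defines "W \<equiv> singular_boundaries d X :: (((nat \<Rightarrow> real) \<Rightarrow> 'a) \<Rightarrow>\<^sub>0 'k::field) set"
  shows "carrier (singular_homology d X) = coset W ` singular_cycles d X"
    and "\<zero>\<^bsub>singular_homology d X\<^esub> = W"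
    and "coset W x \<oplus>\<^bsub>singular_homology d X\<^esub> coset W y = coset W (x + y)"
    and "r \<odot>\<^bsub>singular_homology d X\<^esub> coset W x = coset W (Poly_Mapping.map ((*) r) x)"
proof -
  have W: "linear_subset W" unfolding W_def by (rule singular_boundaries_closed)
  show "carrier (singular_homology d X) = coset W ` singular_cycles d X"
    by (auto simp: singular_homology_def quotient_vs_def A_RCOSETS_def' W_def[symmetric]
        a_r_coset_coset singular_chains_def free_vs_def)
  show "\<zero>\<^bsub>singular_homology d X\<^esub> = W" by (simp add: singular_homology_def quotient_vs_def W_def)
  have "coset W x \<oplus>\<^bsub>singular_homology d X\<^esub> coset W y = (\<Union>h\<in>coset W x. \<Union>k\<in>coset W y. {h + k})"
    by (simp add: singular_homology_def quotient_vs_def set_add_def' singular_chains_def free_vs_def)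
  also have "\<dots> = coset W (x + y)"
  proof (intro equalityI subsetI)
    fix z assume "z \<in> (\<Union>h\<in>coset W x. \<Union>k\<in>coset W y. {h + k})"
    then obtain u v where uv: "u \<in> W" "v \<in> W" "z = (u + x) + (v + y)" by (auto simp: coset_def)
    have "u + v \<in> W" using W uv by (simp add: linear_subset_def)
    then show "z \<in> coset W (x + y)"
      unfolding coset_def by (rule rev_image_eqI) (simp add: uv algebra_simps)
  next
    fix z assume "z \<in> coset W (x + y)"
    then obtain u where u: "u \<in> W" "z = (u + x) + (0 + y)" by (auto simp: coset_def algebra_simps)
    have "0 \<in> W" using W by (simp add: linear_subset_def)
    then show "z \<in> (\<Union>h\<in>coset W x. \<Union>k\<in>coset W y. {h + k})"
      unfolding coset_def using u by blast
  qed
  finally show "coset W x \<oplus>\<^bsub>singular_homology d X\<^esub> coset W y = coset W (x + y)" .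
  have "r \<odot>\<^bsub>singular_homology d X\<^esub> coset W x = (\<Union>z\<in>coset W x. coset W (Poly_Mapping.map ((*) r) z))"
    by (simp add: singular_homology_def quotient_vs_def W_def[symmetric] a_r_coset_coset singular_chains_def free_vs_def)
  also have "\<dots> = (\<Union>z\<in>coset W x. coset W (Poly_Mapping.map ((*) r) x))"
  proof (rule SUP_cong)
    fix z assume "z \<in> coset W x"
    then obtain u where u: "u \<in> W" "z = u + x" by (auto simp: coset_def)
    then have "Poly_Mapping.map ((*) r) z - Poly_Mapping.map ((*) r) x \<in> W"
      using W by (simp add: map_mult_simps linear_subset_def)
    then show "coset W (Poly_Mapping.map ((*) r) z) = coset W (Poly_Mapping.map ((*) r) x)"
      using coset_eq_iff[OF W] by blast
  qed simp
  also have "\<dots> = coset W (Poly_Mapping.map ((*) r) x)"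
    using W by (auto simp: coset_def linear_subset_def)
  finally show "r \<odot>\<^bsub>singular_homology d X\<^esub> coset W x = coset W (Poly_Mapping.map ((*) r) x)" .
qed

lemma singular_cycles_mono:
  assumes "A \<subseteq> B"
  shows "singular_cycles d (underlying_space A) \<subseteq> singular_cycles d (underlying_space B)"
  using singular_simplex_set_underlying_space_mono[OF assms, of d]
  by (auto simp: singular_cycles_def carrier_singular_chains)

lemma singular_boundaries_mono:
  assumes "A \<subseteq> B"
  shows "singular_boundaries d (underlying_space A) \<subseteq> singular_boundaries d (underlying_space B)"
  using singular_simplex_set_underlying_space_mono[OF assms, of "Suc d"]
  unfolding singular_boundaries_def carrier_singular_chains by (intro image_mono) blast

lemma simplicial_cycles_mono:
  assumes "A \<subseteq> B"
  shows "simplicial_cycles d A \<subseteq> simplicial_cycles d B"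
  using assms by (auto simp: simplicial_cycles_def carrier_simplicial_chains)

text \<open>
On chains the inclusion acts as the identity, so all representatives of a class have the same class in
the larger space.
\<close>

lemma homology_map_coset:
  assumes AB: "A \<subseteq> B" and c: "c \<in> singular_cycles d (underlying_space A)"
  shows "homology_map d (underlying_space B) id (coset (singular_boundaries d (underlying_space A)) c) =
    coset (singular_boundaries d (underlying_space B)) (c :: _ \<Rightarrow>\<^sub>0 'k::field)"
proof -
  let ?WA = "singular_boundaries d (underlying_space A) :: (_ \<Rightarrow>\<^sub>0 'k) set"
  let ?WB = "singular_boundaries d (underlying_space B) :: (_ \<Rightarrow>\<^sub>0 'k) set"
  have WB: "linear_subset ?WB" by (rule singular_boundaries_closed)
  have step: "coset ?WB (singular_chain_map d id z) = coset ?WB c" if z: "z \<in> coset ?WA c" for z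
  proof -
    obtain w where w: "w \<in> ?WA" "z = w + c" using z by (auto simp: coset_def)
    obtain v where v: "Poly_Mapping.keys v \<subseteq> singular_simplex_set (Suc d) (underlying_space A)"
      "w = singular_boundary (Suc d) v"
      using w(1) by (auto simp: singular_boundaries_def carrier_singular_chains)
    have "Poly_Mapping.keys w \<subseteq> singular_simplex_set d (underlying_space A)"
    proof -
      interpret T: based_complex "\<lambda>p. singular_simplex_set p (underlying_space A)" chain_boundary
        by (rule singular_based_complex)
      show ?thesis unfolding v(2) singular_boundary_base_change
        using v(1) T.bd_closed by (intro keys_base_change_subset) blast
    qed
    then have keys: "Poly_Mapping.keys z \<subseteq> singular_simplex_set d (underlying_space A)"
      using c keys_add[of w c] w(2) by (auto simp: singular_cycles_def carrier_singular_chains)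
    have "singular_chain_map d id z = base_change frag_of z"
      unfolding singular_chain_map_def base_change_def linear_extension_def
    proof (rule sum.cong)
      fix f assume "f \<in> Poly_Mapping.keys z"
      then have "simplex_map d id f = f" using keys by (intro simplex_map_id_gen[of d "underlying_space A"]) auto
      moreover have "Poly_Mapping.single f (1::'k) = Poly_Mapping.map of_int (frag_of f)"
        by (rule poly_mapping_eqI) (simp add: lookup_single when_def)
      ultimately show "Poly_Mapping.map ((*) (Poly_Mapping.lookup z f)) (Poly_Mapping.single (simplex_map d id f) 1) =
          Poly_Mapping.map ((*) (Poly_Mapping.lookup z f)) (Poly_Mapping.map of_int (frag_of f))"
        by simp
    qed simp
    moreover have "z - c \<in> ?WB" using w singular_boundaries_mono[OF AB, of d] by auto
    ultimately show ?thesis using coset_eq_iff[OF WB] by simp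
  qed
  have "coset ?WA c \<noteq> {}"
    using singular_boundaries_closed[of d "underlying_space A"] by (auto simp: coset_def linear_subset_def)
  then show ?thesis
    using step by (simp add: homology_map_def a_r_coset_coset singular_chains_def free_vs_def)
qed

section \<open>Ranks and Moebius inversion\<close>

text \<open>
Rank and nullity for the map that sends a simplicial cycle of \<open>A\<close> to its class in the homology of \<open>B\<close>.
Its kernel consists of the cycles that bound in \<open>B\<close>; its image is the image of the homology of \<open>A\<close>,
since every singular cycle of \<open>A\<close> is homologous to a simplicial one.
\<close>

lemma birth_death_rank:
  fixes J :: "('v::linorder set \<Rightarrow>\<^sub>0 'k::field) \<Rightarrow> (((nat \<Rightarrow> real) \<Rightarrow> 'v \<Rightarrow> real) \<Rightarrow>\<^sub>0 'k)"
  assumes add: "\<And>c c'. J (c + c') = J c + J c'"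
    and smult: "\<And>r c. J (Poly_Mapping.map ((*) r) c) = Poly_Mapping.map ((*) r) (J c)"
    and cycles: "\<And>z. z \<in> simplicial_cycles d A \<Longrightarrow> J z \<in> singular_cycles d (underlying_space A)"
    and surj: "\<And>c. c \<in> singular_cycles d (underlying_space A) \<Longrightarrow>
      \<exists>z\<in>simplicial_cycles d A. c - J z \<in> singular_boundaries d (underlying_space A)"
    and bound: "\<And>z. z \<in> simplicial_cycles d B \<Longrightarrow>
      J z \<in> singular_boundaries d (underlying_space B) \<longleftrightarrow> z \<in> simplicial_boundaries d B"
    and AB: "A \<subseteq> B" and fin: "finite A"
    and H: "vectorspace class_ring (singular_homology d (underlying_space B) :: ('k, _) module)"
  shows "int (vectorspace.dim class_ring ((singular_homology d (underlying_space B) :: ('k, _) module)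
        \<lparr>carrier := coset (singular_boundaries d (underlying_space B)) ` singular_cycles d (underlying_space A)\<rparr>))
     + int (vectorspace.dim class_ring ((simplicial_chains d B :: ('k, _) module)
        \<lparr>carrier := simplicial_cycles d A \<inter> simplicial_boundaries d B\<rparr>))
     = int (vectorspace.dim class_ring ((simplicial_chains d A :: ('k, _) module)
        \<lparr>carrier := simplicial_cycles d A\<rparr>))"
proof -
  let ?C = "simplicial_chains d A :: ('k, 'v set \<Rightarrow>\<^sub>0 'k) module"
  let ?Z = "simplicial_cycles d A :: ('v set \<Rightarrow>\<^sub>0 'k) set"
  let ?V = "?C\<lparr>carrier := ?Z\<rparr>"
  let ?H = "singular_homology d (underlying_space B) :: ('k, (((nat \<Rightarrow> real) \<Rightarrow> 'v \<Rightarrow> real) \<Rightarrow>\<^sub>0 'k) set) module"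
  let ?W = "singular_boundaries d (underlying_space B) :: (((nat \<Rightarrow> real) \<Rightarrow> 'v \<Rightarrow> real) \<Rightarrow>\<^sub>0 'k) set"
  let ?T = "\<lambda>z. coset ?W (J z)"
  have W: "linear_subset ?W" by (rule singular_boundaries_closed)
  interpret C: vectorspace class_ring ?C
    unfolding simplicial_chains_def by (rule free_vs_vectorspace)
  have V: "vectorspace class_ring ?V"
    by (rule C.subspace_is_vs[OF simplicial_cycles_subspace])
  have fdC: "C.fin_dim"
    unfolding simplicial_chains_def by (rule free_vs_fin_dim) (simp add: fin)
  have fd: "vectorspace.fin_dim class_ring ?V"
    by (rule C.subspace_fin_dim[OF fdC simplicial_cycles_subspace])
  have cyclesB: "J z \<in> singular_cycles d (underlying_space B)" if "z \<in> ?Z" for z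
    using cycles[OF that] singular_cycles_mono[OF AB] by blast
  have hom: "?T \<in> module_hom class_ring ?V ?H"
    using cyclesB unfolding module_hom_def
    by (auto simp: singular_homology_simps simplicial_chains_def free_vs_def add smult)
  interpret H: vectorspace class_ring ?H by (rule H)
  interpret V: vectorspace class_ring ?V by (rule V)
  interpret T: linear_map class_ring ?V ?H ?T
    by unfold_locales (rule hom)
  have ker: "T.kerT = ?Z \<inter> simplicial_boundaries d B"
  proof -
    have "coset ?W (J z) = ?W \<longleftrightarrow> z \<in> simplicial_boundaries d B" if "z \<in> ?Z" for z
      using bound[of z] that simplicial_cycles_mono[OF AB] coset_eq_self_iff[OF W] by blast
    then show ?thesis unfolding T.ker_def by (auto simp: singular_homology_simps)
  qed
  have im: "T.imT = coset ?W ` singular_cycles d (underlying_space A)"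
  proof -
    have "coset ?W c \<in> ?T ` ?Z" if c: "c \<in> singular_cycles d (underlying_space A)" for c
    proof -
      obtain z where z: "z \<in> ?Z" "c - J z \<in> singular_boundaries d (underlying_space A)"
        using surj[OF c] by blast
      then have "c - J z \<in> ?W" using singular_boundaries_mono[OF AB] by blast
      then have "coset ?W c = ?T z" using coset_eq_iff[OF W] by blast
      then show ?thesis using z(1) by blast
    qed
    then show ?thesis unfolding T.im_def using cycles by auto
  qed
  have "?V\<lparr>carrier := ?Z \<inter> simplicial_boundaries d B\<rparr> =
    (simplicial_chains d B :: ('k, 'v set \<Rightarrow>\<^sub>0 'k) module)\<lparr>carrier := ?Z \<inter> simplicial_boundaries d B\<rparr>"
    by (simp add: simplicial_chains_def free_vs_def)
  then show ?thesis
    using T.rank_nullity[OF fd] unfolding ker im by (simp flip: of_nat_add)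
qed

text \<open>
The image of the injective map \<open>f\<close> has the dimension of \<open>V\<close>, and rank and nullity apply to the
restriction of \<open>g\<close> to this image.
\<close>

lemma composite_rank_nullity:
  fixes V :: "('k::field, 'e) module" and V' :: "('k, 'e) module" and H :: "('k, 'h) module"
  assumes a: "linear_map class_ring V V' f" "inj_on f (carrier V)"
    and fd: "vectorspace.fin_dim class_ring V" "vectorspace.fin_dim class_ring V'"
    and g: "linear_map class_ring V' H g"
  shows "int (vectorspace.dim class_ring (H\<lparr>carrier := g ` f ` carrier V\<rparr>))
     + int (vectorspace.dim class_ring (V'\<lparr>carrier := f ` carrier V \<inter> mod_hom.ker V' H g\<rparr>))
     = int (vectorspace.dim class_ring V)"
proof -
  interpret a: linear_map class_ring V V' f by (rule a(1))
  interpret g: linear_map class_ring V' H g by (rule g)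
  let ?I = "V'\<lparr>carrier := f ` carrier V\<rparr>"
  have im_a: "a.imT = f ` carrier V" by (simp add: a.im_def)
  have sub: "VectorSpace.subspace class_ring (f ` carrier V) V'"
    using a.imT_is_subspace by (simp add: im_a)
  have I: "vectorspace class_ring ?I" by (rule a.W.subspace_is_vs[OF sub])
  have fdI: "vectorspace.fin_dim class_ring ?I" by (rule a.W.subspace_fin_dim[OF fd(2) sub])
  have fV: "f x \<in> carrier V'" if "x \<in> carrier V" for x using that by simp
  interpret I: vectorspace class_ring ?I by (rule I)
  have hom: "g \<in> module_hom class_ring ?I H"
    using fV g.f_im unfolding module_hom_def by auto
  interpret r: linear_map class_ring ?I H g by unfold_locales (rule hom)
  have "r.imT = g ` f ` carrier V" by (simp add: r.im_def)
  moreover have "r.kerT = f ` carrier V \<inter> mod_hom.ker V' H g"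
    unfolding r.ker_def g.ker_def using fV by auto
  moreover have "vectorspace.dim class_ring ?I = vectorspace.dim class_ring V"
    using a.rank_nullity[OF fd(1)] a.inj_imp_dim_ker0[OF a(2)] by (simp add: im_a)
  ultimately show ?thesis using r.rank_nullity[OF fdI] by (simp flip: of_nat_add)
qed

lemma direct_sum_arr_principal:
  assumes "y \<in> carrier (obj (direct_sum_module I (\<lambda>i. principal_module (g i))) a)"
  shows "arr (direct_sum_module I (\<lambda>i. principal_module (g i))) a b y = y"
proof
  fix i
  show "arr (direct_sum_module I (\<lambda>i. principal_module (g i))) a b y i = y i"
    using assms by (cases "i \<in> I")
      (auto simp: direct_sum_module_def principal_module_def PiE_def Pi_def extensional_def split: if_splits)
qed

text \<open>
In a direct sum of principal modules the structure maps are inclusions of subspaces, and injectivity is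
transported along the isomorphism.
\<close>

lemma free_module_arr_inj:
  assumes E: "free_module P E" and a: "a \<in> P" and b: "b \<in> P" and ab: "a \<le> b"
  shows "inj_on (arr E a b) (carrier (obj E a))"
proof -
  obtain I :: "nat set" and g
    where iso: "isomorphic_modules P E (direct_sum_module I (\<lambda>i. principal_module (g i)))"
    using E unfolding free_module_def by blast
  let ?D = "direct_sum_module I (\<lambda>i. principal_module (g i))"
  obtain \<theta> where nat: "natural_transformation P E ?D \<theta>"
    and bij: "\<And>a. a \<in> P \<Longrightarrow> bij_betw (\<theta> a) (carrier (obj E a)) (carrier (obj ?D a))"
    using iso unfolding isomorphic_modules_def by blast
  have sq: "\<theta> b (arr E a b x) = \<theta> a x" if x: "x \<in> carrier (obj E a)" for x
  proof -
    have "\<theta> b (arr E a b x) = arr ?D a b (\<theta> a x)"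
      using nat a b ab x unfolding natural_transformation_def by blast
    also have "\<dots> = \<theta> a x"
      using bij[OF a] x by (intro direct_sum_arr_principal) (auto simp: bij_betw_def)
    finally show ?thesis .
  qed
  show ?thesis
  proof (rule inj_onI)
    fix x y assume xy: "x \<in> carrier (obj E a)" "y \<in> carrier (obj E a)" "arr E a b x = arr E a b y"
    then have "\<theta> a x = \<theta> a y" using sq by metis
    then show "x = y" using bij[OF a] xy by (auto simp: bij_betw_def inj_on_def)
  qed
qed

lemma moebius_inversion_sum:
  assumes "finite Q"
  shows "b \<in> Q \<Longrightarrow> m b = (\<Sum>a | a \<in> Q \<and> a \<le> b. moebius_inversion Q m a)"
  using theI'[OF moebius_inversion_ex1[OF assms, of m]] unfolding moebius_inversion_def by blast

lemma moebius_inversion_unique: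
  assumes "finite Q" "\<And>b. b \<in> Q \<Longrightarrow> m b = (\<Sum>a | a \<in> Q \<and> a \<le> b. g a)" "\<And>b. b \<notin> Q \<Longrightarrow> g b = 0"
  shows "moebius_inversion Q m = g"
  unfolding moebius_inversion_def
  by (rule the1_equality[OF moebius_inversion_ex1[OF assms(1)]]) (use assms in blast)

text \<open>
A function of the left end point is the sum over smaller intervals of a function that is supported on
the trivial intervals $[c,c]$, where it is the Moebius inversion on the poset itself. By uniqueness this
is its Moebius inversion on intervals.
\<close>

lemma interval_equiv_of_difference_depending_on_start:
  fixes P :: "'p::order set"
  assumes P: "finite P"
    and diff: "\<And>a b. a \<in> P \<Longrightarrow> b \<in> P \<Longrightarrow> a \<le> b \<Longrightarrow> m (a, b) - n (a, b) = f a"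
  shows "interval_equiv P (moebius_inversion (intervals P) m) (moebius_inversion (intervals P) n)"
proof -
  let ?Q = "intervals P"
  have finQ: "finite ?Q"
    by (rule finite_subset[of _ "P \<times> P"]) (use P in \<open>auto simp: intervals_def\<close>)
  let ?g = "moebius_inversion ?Q n"
  \<comment> \<open>The inversion of \<open>f\<close>, moved to the diagonal.\<close>
  define \<delta> where "\<delta> = (\<lambda>I :: 'p \<times> 'p. if fst I = snd I \<and> fst I \<in> P then moebius_inversion P f (fst I) else 0)"
  have \<delta>: "(\<Sum>I | I \<in> ?Q \<and> I \<le> (a, b). \<delta> I) = f a" if ab: "a \<in> P" "b \<in> P" "a \<le> b" for a b
  proof -
    have "(\<Sum>I | I \<in> ?Q \<and> I \<le> (a, b). \<delta> I) = (\<Sum>I\<in>(\<lambda>c. (c, c)) ` {c. c \<in> P \<and> c \<le> a}. \<delta> I)"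
    proof (rule sum.mono_neutral_right)
      show "finite {I. I \<in> ?Q \<and> I \<le> (a, b)}" using finQ by simp
      show "(\<lambda>c. (c, c)) ` {c. c \<in> P \<and> c \<le> a} \<subseteq> {I. I \<in> ?Q \<and> I \<le> (a, b)}"
        using ab by (auto simp: intervals_def intro: order_trans)
    qed (auto simp: \<delta>_def image_iff)
    also have "\<dots> = (\<Sum>c | c \<in> P \<and> c \<le> a. moebius_inversion P f c)"
      by (subst sum.reindex) (auto simp: inj_on_def \<delta>_def intro!: sum.cong)
    also have "\<dots> = f a" using moebius_inversion_sum[OF P ab(1), of f] by simp
    finally show ?thesis .
  qed
  have "moebius_inversion ?Q m = (\<lambda>I. ?g I + \<delta> I)"
  proof (rule moebius_inversion_unique[OF finQ])
    fix I assume I: "I \<in> ?Q"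
    then obtain a b where ab: "I = (a, b)" "a \<in> P" "b \<in> P" "a \<le> b" by (auto simp: intervals_def)
    have "n I = (\<Sum>J | J \<in> ?Q \<and> J \<le> I. ?g J)" by (rule moebius_inversion_sum[OF finQ I])
    then show "m I = (\<Sum>J | J \<in> ?Q \<and> J \<le> I. ?g J + \<delta> J)"
      using \<delta>[OF ab(2-4)] diff[OF ab(2-4)] by (simp add: sum.distrib ab(1))
  next
    fix I assume I: "I \<notin> ?Q"
    have "?g I = 0"
      using theI'[OF moebius_inversion_ex1[OF finQ, of n]] I unfolding moebius_inversion_def by blast
    moreover have "\<delta> I = 0" using I by (auto simp: \<delta>_def intervals_def split: prod.splits)
    ultimately show "?g I + \<delta> I = 0" by simp
  qed
  then show ?thesis by (auto simp: interval_equiv_def \<delta>_def)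
qed

theorem proposition6p3:
  fixes P :: "'p::order set"
    and K :: "'v::linorder set set"
    and F :: "'p \<Rightarrow> 'v set set"
    and d :: nat
    and E :: "('p, 'k::field, 'e) persistence_data"
    and \<phi> :: "'p \<Rightarrow> 'e \<Rightarrow> (((nat \<Rightarrow> real) \<Rightarrow> 'v \<Rightarrow> real) \<Rightarrow>\<^sub>0 'k) set"
  assumes "finite P"
    and "abstract_complex K" and "finite K"
    and "filtration P K F"
    and "free_presentation P E (homology_module d F) \<phi>"
  shows "interval_equiv P
           (moebius_inversion (intervals P) (birth_death TYPE('k) d F))
           (moebius_inversion (intervals P) (presentation_birth_death E (homology_module d F) \<phi>))"
proof -
  let ?M = "homology_module d F :: ('p, 'k, (((nat \<Rightarrow> real) \<Rightarrow> 'v \<Rightarrow> real) \<Rightarrow>\<^sub>0 'k) set) persistence_data"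
  let ?X = "\<lambda>a. underlying_space (F a)"
  let ?H = "\<lambda>a. singular_homology d (?X a) :: ('k, (((nat \<Rightarrow> real) \<Rightarrow> 'v \<Rightarrow> real) \<Rightarrow>\<^sub>0 'k) set) module"
  have M: "obj ?M a = ?H a" "arr ?M a b = homology_map d (?X b) id" for a b
    by (simp_all add: homology_module_def)
  have free: "free_module P E" and nat: "natural_transformation P E ?M \<phi>"
    and surj: "\<And>a. a \<in> P \<Longrightarrow> \<phi> a ` carrier (obj E a) = carrier (?H a)"
    using assms(5) unfolding free_presentation_def M by auto
  have E: "persistence_module P E" using free by (simp add: free_module_def)
  have complex: "F a \<subseteq> full_complex" "face_closed (F a)" "finite (F a)" if "a \<in> P" for a
  proof -
    have "F a \<subseteq> K" "face_closed (F a)"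
      using assms(4) that by (auto simp: filtration_def subcomplexes_def Pi_def)
    then show "F a \<subseteq> full_complex" "face_closed (F a)" "finite (F a)"
      using assms(2,3) by (auto simp: abstract_complex_def intro: finite_subset)
  qed
  have mono: "F a \<subseteq> F b" if "a \<in> P" "b \<in> P" "a \<le> b" for a b
    using assms(4) that by (auto simp: filtration_def)
  obtain J :: "('v set \<Rightarrow>\<^sub>0 'k) \<Rightarrow> (((nat \<Rightarrow> real) \<Rightarrow> 'v \<Rightarrow> real) \<Rightarrow>\<^sub>0 'k)" where
    J_add: "\<And>c c'. J (c + c') = J c + J c'" and
    J_smult: "\<And>r c. J (Poly_Mapping.map ((*) r) c) = Poly_Mapping.map ((*) r) (J c)" and
    J: "\<forall>A. A \<subseteq> full_complex \<and> face_closed A \<and> finite A \<longrightarrow>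
       (\<forall>z\<in>simplicial_cycles d A. J z \<in> singular_cycles d (underlying_space A) \<and>
          (J z \<in> singular_boundaries d (underlying_space A) \<longleftrightarrow> z \<in> simplicial_boundaries d A)) \<and>
       (\<forall>c\<in>singular_cycles d (underlying_space A).
          \<exists>z\<in>simplicial_cycles d A. c - J z \<in> singular_boundaries d (underlying_space A))"
    using simplicial_singular_comparison[of d] by blast
  have JF: "\<And>z. z \<in> simplicial_cycles d (F a) \<Longrightarrow> J z \<in> singular_cycles d (?X a)"
    "\<And>z. z \<in> simplicial_cycles d (F a) \<Longrightarrow>
       J z \<in> singular_boundaries d (?X a) \<longleftrightarrow> z \<in> simplicial_boundaries d (F a)"
    "\<And>c. c \<in> singular_cycles d (?X a) \<Longrightarrow>
       \<exists>z\<in>simplicial_cycles d (F a). c - J z \<in> singular_boundaries d (?X a)" if "a \<in> P" for a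
    using J complex[OF that] by blast+
  \<comment> \<open>The difference of the two birth-death functions at every interval that starts at \<open>a\<close>.\<close>
  define f where "f a = int (vectorspace.dim class_ring
      ((simplicial_chains d (F a) :: ('k, _) module)\<lparr>carrier := simplicial_cycles d (F a)\<rparr>))
      - int (vectorspace.dim class_ring (obj E a))" for a
  show ?thesis
  proof (rule interval_equiv_of_difference_depending_on_start[OF assms(1)])
    fix a b assume ab: "a \<in> P" "b \<in> P" "a \<le> b"
    \<comment> \<open>The presentation itself provides the vector space structure on homology.\<close>
    have vs: "vectorspace class_ring (?H b)"
      using nat ab unfolding natural_transformation_def linear_map_def M by blast
    let ?W = "\<lambda>a. singular_boundaries d (?X a) :: (((nat \<Rightarrow> real) \<Rightarrow> 'v \<Rightarrow> real) \<Rightarrow>\<^sub>0 'k) set"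
    have "\<phi> b ` arr E a b ` carrier (obj E a) = homology_map d (?X b) id ` \<phi> a ` carrier (obj E a)"
      using nat ab unfolding natural_transformation_def M image_image by (intro image_cong) auto
    also have "\<dots> = (\<lambda>c. homology_map d (?X b) id (coset (?W a) c)) ` singular_cycles d (?X a)"
      by (simp add: surj[OF ab(1)] singular_homology_simps image_image)
    also have "\<dots> = coset (?W b) ` singular_cycles d (?X a)"
      using homology_map_coset[OF mono[OF ab]] by (intro image_cong) auto
    finally have im: "\<phi> b ` arr E a b ` carrier (obj E a) = coset (?W b) ` singular_cycles d (?X a)" .
    have "int (vectorspace.dim class_ring ((?H b)\<lparr>carrier := \<phi> b ` arr E a b ` carrier (obj E a)\<rparr>))
        + presentation_birth_death E ?M \<phi> (a, b) = int (vectorspace.dim class_ring (obj E a))"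
      unfolding presentation_birth_death_def prod.case M
    proof (rule composite_rank_nullity)
      show "linear_map class_ring (obj E a) (obj E b) (arr E a b)"
        "vectorspace.fin_dim class_ring (obj E a)" "vectorspace.fin_dim class_ring (obj E b)"
        using E ab by (auto simp: persistence_module_def)
      show "inj_on (arr E a b) (carrier (obj E a))" by (rule free_module_arr_inj[OF free ab])
      show "linear_map class_ring (obj E b) (?H b) (\<phi> b)"
        using nat ab by (auto simp: natural_transformation_def M)
    qed
    moreover have "int (vectorspace.dim class_ring ((?H b)\<lparr>carrier := coset (?W b) ` singular_cycles d (?X a)\<rparr>))
        + birth_death TYPE('k) d F (a, b) = int (vectorspace.dim class_ring
          ((simplicial_chains d (F a) :: ('k, _) module)\<lparr>carrier := simplicial_cycles d (F a)\<rparr>))"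
      unfolding birth_death_def prod.case
      by (rule birth_death_rank[OF J_add J_smult JF(1)[OF ab(1)] JF(3)[OF ab(1)] JF(2)[OF ab(2)]
            mono[OF ab] complex(3)[OF ab(1)] vs])
    ultimately show "birth_death TYPE('k) d F (a, b) - presentation_birth_death E ?M \<phi> (a, b) = f a"
      unfolding f_def im by linarith
  qed
qed

end
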